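(* Let $n$ be a positive integer and let $k,m,a$ be complex numbers such that all the functions below are defined. Then $$\sum _{p=1}^{2 n} (-1)^p e^{\frac{i p \pi }{n}}\, \Phi \left(-e^{i \left(m+\frac{p \pi }{n}\right)},-k,a\right)=(-1)^{n+1} e^{i m (-1+n)} (2n)^{1+k}\, \Phi \left(e^{2 i m n},-k,\frac{-1+a+n}{2 n}\right).$$
   Context: $\Phi(z,s,v)$ is the Hurwitz–Lerch zeta function: $\Phi(z,s,v)=\sum_{j=0}^{\infty}\frac{z^j}{(j+v)^s}$ for $v\notin\{0,-1,-2,\dots\}$ and $|z|<1$ (or $|z|=1$, $\operatorname{Re}s>1$), and by analytic continuation (principal branch, cut along $z\in[1,\infty)$) for other values; $\Phi(1,s,v)$ is the Hurwitz zeta function $\zeta(s,v)$. Powers are principal values. *)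

theory Defs
  imports "HOL-Complex_Analysis.Complex_Analysis"
begin

text \<open>
  Analytic continuation of \<open>f\<close> from \<open>A\<close> to \<open>B\<close>. It is used below only with \<open>A\<close> open and nonempty
  and with \<open>B \<supseteq> A\<close> open and connected, so that by the identity theorem the continuation is
  unique on \<open>B\<close>; outside \<open>B\<close> the value is meaningless.
\<close>
definition analytic_continuation ::
    "(complex \<Rightarrow> complex) \<Rightarrow> complex set \<Rightarrow> complex set \<Rightarrow> complex \<Rightarrow> complex" where
  "analytic_continuation f A B = (SOME g. g holomorphic_on B \<and> (\<forall>x\<in>A. g x = f x))"

definition lerch_series :: "complex \<Rightarrow> complex \<Rightarrow> complex \<Rightarrow> complex" where
  "lerch_series z s v = (\<Sum>j. z ^ j / (of_nat j + v) powr s)"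

definition hurwitz_zeta :: "complex \<Rightarrow> complex \<Rightarrow> complex" where
  "hurwitz_zeta s v =
     analytic_continuation (\<lambda>s'. lerch_series 1 s' v) {s'. Re s' > 1} (- {1}) s"

definition lerch_cut :: "complex set" where
  "lerch_cut = complex_of_real ` {1..}"

text \<open>
  For fixed \<open>s\<close> and \<open>v\<close> the series is continued in \<open>z\<close> from the unit disc to the plane cut along
  \<open>[1,\<infinity>)\<close>. At the branch point \<open>z = 1\<close> the value is the Hurwitz zeta function, which is instead
  a continuation in \<open>s\<close>.
\<close>
definition hurwitz_lerch :: "complex \<Rightarrow> complex \<Rightarrow> complex \<Rightarrow> complex" where
  "hurwitz_lerch z s v =
     (if norm z < 1 \<or> norm z = 1 \<and> Re s > 1 then lerch_series z s v
      else if z = 1 then hurwitz_zeta s v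
      else analytic_continuation (\<lambda>z'. lerch_series z' s v) (ball 0 1) (- lerch_cut) z)"

text \<open>
  The domain of the principal branch: the cut plane, together with \<open>z = 1\<close> unless \<open>s = 1\<close>, where
  the Hurwitz zeta function has its pole. On the rest of the cut, \<open>z > 1\<close>, the principal branch
  is left undefined.
\<close>
definition hurwitz_lerch_defined :: "complex \<Rightarrow> complex \<Rightarrow> complex \<Rightarrow> bool" where
  "hurwitz_lerch_defined z s v \<longleftrightarrow>
     v \<notin> \<int>\<^sub>\<le>\<^sub>0 \<and> (z \<notin> lerch_cut \<or> z = 1 \<and> s \<noteq> 1)"

end

theory Submission
  imports Defs "HOL-Real_Asymp.Real_Asymp"
begin

text \<open>
  Put \<open>w = exp (\<i> m)\<close>, \<open>s = - k\<close> and let \<open>\<omega> = exp (\<i> pi / n)\<close>. The points \<open>- w \<omega>\<^sup>p\<close>, \<open>1 \<le> p \<le> 2n\<close>,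
  are the \<open>2n\<close>-th roots of \<open>w\<^sup>2\<^sup>n\<close>, and summing their powers against the weights \<open>(- \<omega>)\<^sup>p\<close>
  annihilates every term of the Lerch series whose index \<open>j\<close> is not of the form \<open>2nl + n - 1\<close>. The
  surviving terms have \<open>j + a = 2n (l + b)\<close> with \<open>b = (a + n - 1) / (2n)\<close>, and a positive real factor
  can be pulled out of a principal power. This is the identity wherever the series
  converge (\<open>lerch_multisection_series\<close>). Everywhere else it follows from the identity theorem, so that
  the real work is to show that the analytic continuations exist and fit together.

  \<^item> If \<open>w\<^sup>2\<^sup>n\<close> is off the cut, then so are all its roots, and both sides are holomorphic in \<open>w\<close> on a
    star-shaped set (\<open>lerch_multisection_branch\<close>). The continuation of the Lerch series to the cut
    plane (\<open>lerch_continuation_exists\<close>) comes from the representation of \<open>(j + v) powr (- s)\<close> as the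
    \<open>j\<close>-th moment of a continuous function on \<open>[0,1]\<close>, which turns the series into an integral against
    \<open>1 / (1 - z x)\<close>; this needs \<open>Re s\<close> and \<open>Re v\<close> to be large, and the operator \<open>z d/dz + v\<close> and a
    shift of the index remove the restrictions.

  \<^item> If \<open>w\<^sup>2\<^sup>n = 1\<close>, one of the roots is the branch point \<open>1\<close>, where the value is defined by continuation
    in \<open>s\<close> instead of \<open>z\<close>. Both sides are therefore compared as functions of \<open>s\<close>
    (\<open>lerch_multisection_circle\<close>), which requires every value \<open>\<Phi>(z,s,v)\<close> with \<open>|z| = 1\<close> to be
    holomorphic in \<open>s \<noteq> 1\<close> (\<open>holomorphic_hurwitz_lerch_s\<close>), whichever of the two kinds of continuation
    defines it. For \<open>z \<noteq> 1\<close> and for \<open>z = 1\<close> alike, this rests on the Taylor expansion of \<open>(x + 1) powr (- s)\<close>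
    at infinity: it expresses \<open>(1 - z) \<Phi>(z,s,v)\<close>, or \<open>(s - 1) \<zeta>(s,v)\<close>, through values at
    \<open>s + 1, s + 2, \<dots>\<close> and a remainder series that converges in a larger half-plane.
\<close>

section \<open>The moments of a logarithmic weight\<close>

text \<open>
  The factor \<open>x\<close> beats the logarithmic singularity at \<open>0\<close>; at \<open>x = 1\<close> the logarithm vanishes, which is
  why \<open>Re s > 0\<close> is needed. Splitting off this factor makes all the integrands below
  continuous on the compact interval, so that parametric integrals can be differentiated under the
  integral sign.
\<close>
lemma continuous_on_log_weight:
  assumes "Re s > 0"
  shows "continuous_on {0..1} (\<lambda>x. of_real x * of_real (- ln x) powr s :: complex)"
proof -
  let ?f = "\<lambda>x. of_real x * of_real (- ln x) powr s :: complex"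
  have pos: "continuous_on {0<..1} ?f"
    by (intro continuous_intros) (use assms in auto)
  have lim: "(?f \<longlongrightarrow> 0) (at_right 0)"
  proof (rule Lim_null_comparison)
    show "eventually (\<lambda>x. norm (?f x) \<le> x * (- ln x) powr Re s) (at_right 0)"
      using eventually_at_right_less[of 0] eventually_at_right_real[OF zero_less_one]
      by eventually_elim (auto simp: norm_mult norm_powr_real_powr)
    show "((\<lambda>x. x * (- ln x) powr Re s) \<longlongrightarrow> 0) (at_right 0)"
      using assms by real_asymp
  qed
  have "continuous (at x within {0..1}) ?f" if x: "x \<in> {0..1}" for x
  proof (cases "x = 0")
    case True
    have "(?f \<longlongrightarrow> 0) (at 0 within {0..1})"
      using lim by (simp add: at_within_Icc_at_right)
    then show ?thesis
      using True by (simp add: continuous_within)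
  next
    case False
    then have "continuous (at x within {0<..1}) ?f"
      using pos x by (auto simp: continuous_on_eq_continuous_within)
    moreover have "at x within {0..1} = at x within {0<..1}"
      by (rule at_within_nhd[of _ "{0<..}"]) (use False x in auto)
    ultimately show ?thesis
      by (simp add: continuous_within)
  qed
  then show ?thesis
    by (simp add: continuous_on_eq_continuous_within)
qed

text \<open>
  For real \<open>u\<close> the substitution \<open>t = - u ln x\<close> gives Euler's integral for \<open>Gamma s\<close>.
\<close>
lemma moment_log_weight_real:
  fixes u :: real
  assumes u: "u > 0" and s: "Re s > 0"
  shows "((\<lambda>x. of_real x powr (of_real u - 1) * of_real (- ln x) powr (s - 1))
           has_integral Gamma s * of_real u powr (- s)) {0..1}"
proof -
  let ?g = "\<lambda>x::real. - u * ln x"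
  let ?f = "\<lambda>t::real. of_real t powr (s - 1) / of_real (exp t) :: complex"
  let ?w = "\<lambda>x. of_real x powr (of_real u - 1) * of_real (- ln x) powr (s - 1) :: complex"
  have img: "?g ` {0<..<1} = {0<..}"
  proof (intro equalityI subsetI)
    fix t :: real assume t: "t \<in> {0<..}"
    have "t = ?g (exp (- t / u))" "exp (- t / u) \<in> {0<..<1}"
      using t u by (auto simp: divide_neg_pos)
    then show "t \<in> ?g ` {0<..<1}" by blast
  qed (use u in \<open>auto simp: mult_pos_neg\<close>)
  have der: "(?g has_field_derivative - u / x) (at x within {0<..<1})" if "x \<in> {0<..<1}" for x
    using that by (auto intro!: derivative_eq_intros)
  have inj: "inj_on ?g {0<..<1}"
    using u by (auto simp: inj_on_def)
  have meas: "{0<..<1::real} \<in> sets lebesgue" by simp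
  have "?f absolutely_integrable_on ?g ` {0<..<1} \<and> integral (?g ` {0<..<1}) ?f = Gamma s"
    using absolutely_integrable_Gamma_integral'[OF s] Gamma_integral_complex'[OF s]
    unfolding img by (auto simp: integral_unique)
  then have *: "(\<lambda>x. \<bar>- u / x\<bar> *\<^sub>R ?f (?g x)) absolutely_integrable_on {0<..<1}
      \<and> integral {0<..<1} (\<lambda>x. \<bar>- u / x\<bar> *\<^sub>R ?f (?g x)) = Gamma s"
    by (subst has_absolute_integral_change_of_variables_real[OF meas der inj])
  have "((\<lambda>x. \<bar>- u / x\<bar> *\<^sub>R ?f (?g x)) has_integral Gamma s) {0<..<1}"
    using integrable_integral[OF set_lebesgue_integral_eq_integral(1)[OF conjunct1[OF *]]]
    unfolding conjunct2[OF *] .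
  moreover have "\<bar>- u / x\<bar> *\<^sub>R ?f (?g x) = of_real u powr s * ?w x" if "x \<in> {0<..<1}" for x
  proof -
    have x: "x > 0" "x < 1" using that by auto
    have "of_real (?g x) powr (s - 1) = (of_real u * of_real (- ln x) :: complex) powr (s - 1)"
      by simp
    also have "\<dots> = of_real u powr (s - 1) * of_real (- ln x) powr (s - 1)"
      using x u by (intro powr_times_real) auto
    also have "of_real u powr (s - 1) = of_real u powr s / (of_real u :: complex)"
      using u by (simp add: powr_diff)
    finally have 1: "of_real (?g x) powr (s - 1) =
        of_real u powr s / of_real u * (of_real (- ln x) powr (s - 1) :: complex)" .
    have "exp (?g x) = x powr (- u)" using x by (simp add: powr_def)
    then have 2: "complex_of_real (exp (?g x)) = inverse (of_real x powr of_real u)"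
      using x by (simp add: powr_minus powr_of_real)
    have 3: "of_real x powr (of_real u - 1) = of_real x powr of_real u / (of_real x :: complex)"
      using x by (simp add: powr_diff)
    have 4: "\<bar>- u / x\<bar> = u / x" using x u by simp
    show ?thesis
      unfolding 1 2 3 4 using x u by (simp add: scaleR_conv_of_real, simp add: divide_inverse mult_ac)
  qed
  ultimately have "((\<lambda>x. of_real u powr s * ?w x) has_integral Gamma s) {0<..<1}"
    by (rule has_integral_eq[rotated]) 
  then have "((\<lambda>x. of_real u powr (- s) * (of_real u powr s * ?w x)) has_integral
      of_real u powr (- s) * Gamma s) {0<..<1}"
    by (rule has_integral_mult_right)
  moreover have "of_real u powr (- s) * (of_real u powr s * y) = y" for y :: complex
    using u by (simp add: powr_minus field_simps)
  ultimately show ?thesis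
    using has_integral_open_interval[of ?w _ 0 1] by (simp add: mult.commute)
qed

lemma continuous_on_moment_integrand:
  assumes "Re u > 2" "Re s > 0"
  shows "continuous_on {0..1} (\<lambda>x. of_real x powr (u - 1) * of_real (- ln x) powr s :: complex)"
proof -
  have "continuous_on {0..1}
      (\<lambda>x. of_real x powr (u - 2) * (of_real x * of_real (- ln x) powr s) :: complex)"
    by (intro continuous_on_mult continuous_on_log_weight assms continuous_intros)
       (use assms in auto)
  moreover have "of_real x powr (u - 2) * of_real x = (of_real x :: complex) powr (u - 1)" for x
    using powr_add[of "of_real x :: complex" "u - 2" 1] by simp
  ultimately show ?thesis
    by (simp add: mult.assoc[symmetric])
qed

text \<open>
  For complex \<open>u\<close> a substitution would have to rotate the path of integration. Instead, both sides are
  holomorphic in \<open>u\<close> and agree on the real axis.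
\<close>
lemma moment_log_weight:
  assumes u: "Re u > 2" and s: "Re s > 1"
  shows "((\<lambda>x. of_real x powr (u - 1) * of_real (- ln x) powr (s - 1))
           has_integral Gamma s * u powr (- s)) {0..1}"
proof -
  let ?U = "{u. Re u > 2}"
  let ?w = "\<lambda>u x. of_real x powr (u - 1) * of_real (- ln x) powr (s - 1) :: complex"
  let ?M = "\<lambda>u. integral (cbox 0 1) (?w u)"
  have cvx: "convex ?U" using convex_halfspace_Re_gt by blast
  have opn: "open ?U" by (simp add: open_halfspace_Re_gt)
  have int: "?w u integrable_on cbox 0 1" if "u \<in> ?U" for u
    by (rule integrable_continuous) (use continuous_on_moment_integrand[of u "s - 1"] that s in auto)
  have hol: "?M holomorphic_on ?U"
  proof (rule leibniz_rule_holomorphic[where fx = "\<lambda>u x. of_real (ln x) * ?w u x"])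
    fix u x assume "u \<in> ?U" "x \<in> cbox 0 (1::real)"
    \<comment> \<open>At \<open>x = 0\<close> the integrand vanishes for all \<open>u\<close>, since \<open>0 powr u = 0\<close>, and so does the derivative.\<close>
    show "((\<lambda>u. ?w u x) has_field_derivative of_real (ln x) * ?w u x) (at u within ?U)"
    proof (cases "x = 0")
      case False
      with \<open>x \<in> cbox 0 1\<close> have x: "x > 0" by simp
      have "((\<lambda>u. of_real x powr (u - 1)) has_field_derivative
          Ln (of_real x) * of_real x powr (u - 1) * 1) (at u)"
        by (rule DERIV_chain2[OF has_field_derivative_powr_right])
           (use x in \<open>auto intro!: derivative_eq_intros\<close>)
      from DERIV_cmult_right[OF this, of "of_real (- ln x) powr (s - 1)"]
      have "((\<lambda>u. ?w u x) has_field_derivative of_real (ln x) * ?w u x) (at u)"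
        using x by (simp only: Ln_of_real mult_1_right mult.assoc)
      then show ?thesis by (rule has_field_derivative_at_within)
    qed auto
  next
    have "continuous_on (?U \<times> {0..1::real}) (\<lambda>y. of_real (snd y) powr (fst y - 2) *
        (of_real (snd y) * of_real (- ln (snd y)) powr s) :: complex)"
    proof (rule continuous_on_mult)
      show "continuous_on (?U \<times> {0..1::real}) (\<lambda>y. of_real (snd y) powr (fst y - 2) :: complex)"
        by (intro continuous_intros) auto
      have "continuous_on (?U \<times> {0..1::real}) snd"
        by (intro continuous_intros)
      from continuous_on_compose2[OF continuous_on_log_weight this] s
      show "continuous_on (?U \<times> {0..1::real})
          (\<lambda>y. of_real (snd y) * of_real (- ln (snd y)) powr s :: complex)" by auto
    qed
    then have "continuous_on (?U \<times> {0..1::real}) (\<lambda>y. - (of_real (snd y) powr (fst y - 2) *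
        (of_real (snd y) * of_real (- ln (snd y)) powr s)) :: complex)"
      by (rule continuous_on_minus)
    moreover have "- (of_real x powr (u - 2) * (of_real x * of_real (- ln x) powr s))
        = of_real (ln x) * ?w u x" for x u
    proof -
      have "of_real x powr (u - 2) * of_real x = (of_real x :: complex) powr (u - 1)"
        using powr_add[of "of_real x :: complex" "u - 2" 1] by simp
      moreover have "of_real (- ln x) powr s = of_real (- ln x) * (of_real (- ln x) :: complex) powr (s - 1)"
        using powr_add[of "of_real (- ln x) :: complex" 1 "s - 1"] by simp
      ultimately show ?thesis
        by (simp add: mult_ac)
    qed
    ultimately show "continuous_on (?U \<times> cbox 0 1) (\<lambda>(u, x). of_real (ln x) * ?w u x)"
      by (simp add: case_prod_unfold)
  qed (use int cvx in auto)
  have eq: "?M u - Gamma s * u powr (- s) = 0"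
  proof (rule analytic_continuation[where S = ?U and U = "complex_of_real ` {2<..}" and \<xi> = 3
        and f = "\<lambda>u. ?M u - Gamma s * u powr (- s)"])
    show "(\<lambda>u. ?M u - Gamma s * u powr (- s)) holomorphic_on ?U"
      by (intro holomorphic_intros hol) (auto simp: complex_nonpos_Reals_iff)
    show "(3::complex) islimpt complex_of_real ` {2<..}"
      unfolding islimpt_approachable
    proof (intro allI impI)
      fix e :: real assume "e > 0"
      then have "complex_of_real (3 + e / 2) \<in> complex_of_real ` {2<..}"
        by (intro imageI) simp
      moreover have "complex_of_real (3 + e / 2) \<noteq> 3" "dist (complex_of_real (3 + e / 2)) 3 < e"
        using \<open>e > 0\<close> by (auto simp: dist_norm)
      ultimately      show "\<exists>x'\<in>complex_of_real ` {2<..}. x' \<noteq> 3 \<and> dist x' 3 < e" by blast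
    qed
    fix z assume "z \<in> complex_of_real ` {2<..}"
    then show "?M z - Gamma s * z powr (- s) = 0"
      using moment_log_weight_real[of _ s] s by (auto simp: integral_unique)
  qed (use opn cvx u in \<open>auto simp: convex_connected\<close>)
  have "(?w u has_integral ?M u) (cbox 0 1)"
    using int[of u] u by (simp add: integrable_integral)
  with eq show ?thesis by simp
qed

section \<open>Continuation of the Lerch series to the cut plane\<close>

lemma lerch_cut_iff: "z \<in> lerch_cut \<longleftrightarrow> Im z = 0 \<and> Re z \<ge> 1"
  unfolding lerch_cut_def by (auto simp: complex_eq_iff image_iff)

lemma closed_lerch_cut: "closed lerch_cut"
proof -
  have "lerch_cut = {z. Im z = 0} \<inter> {z. Re z \<ge> 1}"
    by (auto simp: lerch_cut_iff)
  moreover have "closed {z. Im z = 0}"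
    by (intro closed_Collect_eq continuous_intros)
  ultimately show ?thesis
    by (metis closed_Int closed_halfspace_Re_ge)
qed

lemma mult_of_real_in_lerch_cut_imp:
  assumes "0 \<le> t" "t \<le> 1" "of_real t * z \<in> lerch_cut"
  shows "z \<in> lerch_cut"
proof -
  have *: "t * Re z \<ge> 1" "t * Im z = 0"
    using assms by (auto simp: lerch_cut_iff)
  then have "t \<noteq> 0" by auto
  with * have "Im z = 0" "Re z > 0"
    using assms by (auto simp: zero_less_mult_iff dest!: less_le_trans[OF zero_less_one])
  moreover have "t * Re z \<le> 1 * Re z"
    using assms \<open>Re z > 0\<close> by (intro mult_right_mono) auto
  ultimately show ?thesis
    using * by (auto simp: lerch_cut_iff)
qed

lemma ball_subset_Compl_lerch_cut: "ball 0 1 \<subseteq> - lerch_cut"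
proof
  fix z :: complex assume "z \<in> ball 0 1"
  then have "\<bar>Re z\<bar> < 1"
    using abs_Re_le_cmod[of z] by simp
  then show "z \<in> - lerch_cut"
    by (auto simp: lerch_cut_iff)
qed

text \<open>
  For \<open>x\<close> in \<open>[0,1]\<close> the denominator can vanish only if \<open>z = 1 / x\<close>, which lies on the cut.
\<close>
lemma holomorphic_Stieltjes_kernel:
  fixes \<phi> :: "real \<Rightarrow> complex"
  assumes cont: "continuous_on {0..1} \<phi>"
  shows "(\<lambda>z. integral {0..1} (\<lambda>x. \<phi> x / (1 - z * of_real x))) holomorphic_on - lerch_cut"
proof -
  have nz: "1 - z * of_real x \<noteq> 0" if "z \<in> - lerch_cut" "x \<in> {0..1}" for z and x :: real
  proof
    assume "1 - z * of_real x = 0"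
    then have "of_real x * z \<in> lerch_cut"
      by (simp add: lerch_cut_iff mult.commute)
    with that show False
      using mult_of_real_in_lerch_cut_imp[of x z] by auto
  qed
  have "(\<lambda>z. integral (cbox 0 1) (\<lambda>x. \<phi> x / (1 - z * of_real x))) holomorphic_on ball z0 r"
    if sub: "ball z0 r \<subseteq> - lerch_cut" for z0 r
  proof (rule leibniz_rule_holomorphic[where fx = "\<lambda>z x. \<phi> x * of_real x / (1 - z * of_real x)\<^sup>2"])
    fix z x assume "z \<in> ball z0 r" "x \<in> cbox 0 (1::real)"
    then have "1 - z * of_real x \<noteq> 0" using nz sub by auto
    then show "((\<lambda>z. \<phi> x / (1 - z * of_real x)) has_field_derivative
        \<phi> x * of_real x / (1 - z * of_real x)\<^sup>2) (at z within ball z0 r)"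
      by (auto intro!: derivative_eq_intros simp: power2_eq_square)
  next
    fix z assume "z \<in> ball z0 r"
    then show "(\<lambda>x. \<phi> x / (1 - z * of_real x)) integrable_on cbox 0 1"
      using nz sub by (intro integrable_continuous continuous_intros) (use cont in auto)
  next
    have "continuous_on (ball z0 r \<times> {0..1::real})
        (\<lambda>y. \<phi> (snd y) * of_real (snd y) / (1 - fst y * of_real (snd y))\<^sup>2)"
      by (intro continuous_intros continuous_on_compose2[OF cont]) (use nz sub in auto)
    then show "continuous_on (ball z0 r \<times> cbox 0 1) (\<lambda>(z, x). \<phi> x * of_real x / (1 - z * of_real x)\<^sup>2)"
      by (simp add: case_prod_unfold)
  qed (rule convex_ball)
  note loc = this[unfolded box_real]
  have "\<exists>r>0. (\<lambda>z. integral {0..1} (\<lambda>x. \<phi> x / (1 - z * of_real x))) holomorphic_on ball z0 r"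
    if "z0 \<in> - lerch_cut" for z0
  proof -
    have "open (- lerch_cut)"
      using closed_lerch_cut by (simp add: closed_def)
    from openE[OF this that] obtain r where "r > 0" "ball z0 r \<subseteq> - lerch_cut" .
    then show ?thesis by (intro exI[of _ r] conjI loc)
  qed
  then show ?thesis
    by (intro analytic_imp_holomorphic) (simp add: analytic_on_def)
qed

text \<open>
  Expanding the kernel in a geometric series, which converges uniformly for \<open>x\<close> in \<open>[0,1]\<close>, exhibits
  the integral as the generating function of the moments of \<open>\<phi>\<close>.
\<close>
lemma Stieltjes_kernel_sums:
  fixes \<phi> :: "real \<Rightarrow> complex"
  assumes cont: "continuous_on {0..1} \<phi>" and z: "norm z < 1"
    and moments: "\<And>j. ((\<lambda>x. of_real x ^ j * \<phi> x) has_integral c j) {0..1}"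
  shows "(\<lambda>j. c j * z ^ j) sums integral {0..1} (\<lambda>x. \<phi> x / (1 - z * of_real x))"
proof -
  have "bounded (\<phi> ` {0..1})"
    by (intro compact_imp_bounded compact_continuous_image cont compact_Icc)
  then obtain B where B: "\<And>x. x \<in> {0..1} \<Longrightarrow> norm (\<phi> x) \<le> B"
    unfolding bounded_iff by blast
  let ?f = "\<lambda>n x. \<Sum>j<n. \<phi> x * (z * of_real x) ^ j"
  have small: "norm (z * of_real x) \<le> norm z" if "x \<in> {0..1}" for x :: real
    using that by (auto simp: norm_mult mult_left_le)
  have "uniform_limit {0..1} ?f (\<lambda>x. \<Sum>j. \<phi> x * (z * of_real x) ^ j) sequentially"
  proof (rule Weierstrass_m_test)
    show "summable (\<lambda>j. B * norm z ^ j)"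
      using z by (intro summable_mult summable_geometric) auto
    fix j x assume "x \<in> {0..1::real}"
    then have "norm (\<phi> x) * norm (z * of_real x) ^ j \<le> B * norm z ^ j"
      using B[of x] small[of x]
      by (intro mult_mono power_mono) (auto intro: order_trans[OF norm_ge_zero])
    then show "norm (\<phi> x * (z * of_real x) ^ j) \<le> B * norm z ^ j"
      by (simp only: norm_mult norm_power)
  qed
  moreover have "(\<Sum>j. \<phi> x * (z * of_real x) ^ j) = \<phi> x / (1 - z * of_real x)"
    if "x \<in> {0..1}" for x :: real
  proof -
    have "norm (z * of_real x) < 1" using small[OF that] z by simp
    then show ?thesis
      using sums_mult[OF geometric_sums, of "z * of_real x" "\<phi> x"] by (simp add: sums_iff)
  qed
  ultimately have "uniform_limit {0..1} ?f (\<lambda>x. \<phi> x / (1 - z * of_real x)) sequentially"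
    using uniform_limit_cong'[of "{0..1}" ?f ?f "\<lambda>x. \<Sum>j. \<phi> x * (z * of_real x) ^ j"
      "\<lambda>x. \<phi> x / (1 - z * of_real x)"] by blast
  moreover have "continuous_on {0..1} (?f n)" for n
    by (intro continuous_intros cont)
  ultimately obtain I J where IJ: "\<And>n. (?f n has_integral I n) {0..1}"
    "((\<lambda>x. \<phi> x / (1 - z * of_real x)) has_integral J) {0..1}" "I \<longlonglongrightarrow> J"
    by (rule uniform_limit_integral) auto
  have "I n = (\<Sum>j<n. c j * z ^ j)" for n
  proof -
    have "((\<lambda>x. \<Sum>j<n. (of_real x ^ j * \<phi> x) * z ^ j) has_integral (\<Sum>j<n. c j * z ^ j)) {0..1}"
      by (intro has_integral_sum has_integral_mult_left moments) auto
    moreover have "(\<lambda>x. \<Sum>j<n. (of_real x ^ j * \<phi> x) * z ^ j) = ?f n"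
      by (simp add: power_mult_distrib mult_ac)
    ultimately have "(?f n has_integral (\<Sum>j<n. c j * z ^ j)) {0..1}"
      by (simp only:)
    with IJ(1) show ?thesis by (rule has_integral_unique)
  qed
  then have "I = (\<lambda>n. \<Sum>j<n. c j * z ^ j)" by (rule ext)
  then show ?thesis
    using IJ(3) unfolding sums_def integral_unique[OF IJ(2)] by (simp only:)
qed

lemma lerch_continuation_large:
  assumes v: "Re v > 2" and s: "Re s > 1"
  shows "\<exists>g. g holomorphic_on - lerch_cut \<and>
    (\<forall>z. norm z < 1 \<longrightarrow> (\<lambda>j. (of_nat j + v) powr (- s) * z ^ j) sums g z)"
proof -
  let ?\<phi> = "\<lambda>x. of_real x powr (v - 1) * of_real (- ln x) powr (s - 1) :: complex"
  let ?g = "\<lambda>z. integral {0..1} (\<lambda>x. ?\<phi> x / (1 - z * of_real x))"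
  have cont: "continuous_on {0..1} ?\<phi>"
    using continuous_on_moment_integrand[of v "s - 1"] v s by simp
  have "((\<lambda>x. of_real x ^ j * ?\<phi> x) has_integral Gamma s * (of_nat j + v) powr (- s)) {0..1}" for j
  proof -
    have "of_real x ^ j * (of_real x :: complex) powr (v - 1) = of_real x powr (of_nat j + v - 1)"
      for x :: real
    proof (cases "x = 0")
      case False
      then show ?thesis
        using powr_add[of "of_real x :: complex" "of_nat j" "v - 1"] by (simp add: algebra_simps)
    qed auto
    then show ?thesis
      using moment_log_weight[of "of_nat j + v" s] v s by (simp add: mult.assoc[symmetric])
  qed
  then have sums: "(\<lambda>j. Gamma s * (of_nat j + v) powr (- s) * z ^ j) sums ?g z" if "norm z < 1" for z
    by (rule Stieltjes_kernel_sums[OF cont that])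
  have "Gamma s \<noteq> 0"
    using s by (auto simp: Gamma_eq_zero_iff elim!: nonpos_Ints_cases)
  have "(\<lambda>j. (of_nat j + v) powr (- s) * z ^ j) sums (?g z / Gamma s)" if "norm z < 1" for z
    using sums_divide[OF sums[OF that], of "Gamma s"] \<open>Gamma s \<noteq> 0\<close> by simp
  moreover have "(\<lambda>z. ?g z / Gamma s) holomorphic_on - lerch_cut"
    by (intro holomorphic_intros holomorphic_Stieltjes_kernel cont \<open>Gamma s \<noteq> 0\<close>)
  ultimately show ?thesis by blast
qed

text \<open>
  The operator \<open>z d/dz + v\<close> multiplies the coefficient of \<open>z\<^sup>j\<close> by \<open>j + v\<close> and hence lowers \<open>s\<close> by one.
  A power series may be differentiated termwise in its disc of convergence, so this also proves that
  the series for \<open>s\<close> converges there.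
\<close>
lemma lerch_continuation_lower:
  assumes v: "Re v > 2"
    and ex: "\<exists>g. g holomorphic_on - lerch_cut \<and>
      (\<forall>z. norm z < 1 \<longrightarrow> (\<lambda>j. (of_nat j + v) powr (- (s + 1)) * z ^ j) sums g z)"
  shows "\<exists>g. g holomorphic_on - lerch_cut \<and>
    (\<forall>z. norm z < 1 \<longrightarrow> (\<lambda>j. (of_nat j + v) powr (- s) * z ^ j) sums g z)"
proof -
  let ?c = "\<lambda>j. (of_nat j + v) powr (- (s + 1))"
  obtain g where hol: "g holomorphic_on - lerch_cut"
    and sums: "\<And>z. norm z < 1 \<Longrightarrow> (\<lambda>j. ?c j * z ^ j) sums g z"
    using ex by blast
  have op: "open (- lerch_cut)" using closed_lerch_cut by blast
  have nz: "of_nat j + v \<noteq> 0" for j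
    using v by (auto simp: complex_eq_iff)
  have coeff: "of_nat j * ?c j + v * ?c j = (of_nat j + v) powr (- s)" for j
  proof -
    have "of_nat j * ?c j + v * ?c j = (of_nat j + v) powr (1 + - (s + 1))"
      unfolding powr_add by (simp add: algebra_simps)
    then show ?thesis by simp
  qed
  have "(\<lambda>j. (of_nat j + v) powr (- s) * z ^ j) sums (z * deriv g z + v * g z)" if z: "norm z < 1" for z
  proof -
    have "z \<in> - lerch_cut" using ball_subset_Compl_lerch_cut z by auto
    then have "(g has_field_derivative deriv g z) (at z)"
      using holomorphic_derivI[OF hol op] by blast
    from termdiffs_sums_strong[OF sums this z]
    have "(\<lambda>j. diffs ?c j * z ^ j) sums deriv g z" by blast
    then have "(\<lambda>j. z * (diffs ?c j * z ^ j)) sums (z * deriv g z)"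
      by (rule sums_mult)
    then have "(\<lambda>j. of_nat (Suc j) * ?c (Suc j) * z ^ Suc j) sums (z * deriv g z)"
      by (simp add: diffs_def mult_ac)
    then have "(\<lambda>j. of_nat j * ?c j * z ^ j) sums (z * deriv g z)"
      by (subst (asm) sums_Suc_iff) simp
    from sums_add[OF this sums_mult[OF sums[OF z], of v]]
    have "(\<lambda>j. (of_nat j * ?c j + v * ?c j) * z ^ j) sums (z * deriv g z + v * g z)"
      by (simp add: algebra_simps)
    then show ?thesis unfolding coeff .
  qed
  moreover have "(\<lambda>z. z * deriv g z + v * g z) holomorphic_on - lerch_cut"
    by (intro holomorphic_intros hol op)
  ultimately show ?thesis by blast
qed

lemma lerch_continuation_all_s:
  assumes v: "Re v > 2"
  shows "\<exists>g. g holomorphic_on - lerch_cut \<and>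
    (\<forall>z. norm z < 1 \<longrightarrow> (\<lambda>j. (of_nat j + v) powr (- s) * z ^ j) sums g z)"
proof -
  have all: "Re s > 1 - real N \<Longrightarrow> ?thesis" for N
  proof (induction N arbitrary: s)
    case 0
    then show ?case using lerch_continuation_large[OF v, of s] by simp
  next
    case (Suc N)
    then have "Re (s + 1) > 1 - real N" by simp
    from lerch_continuation_lower[OF v Suc.IH[OF this]] show ?case .
  qed
  obtain N :: nat where "1 - Re s < real N"
    using reals_Archimedean2 by blast
  then have "Re s > 1 - real N" by simp
  then show ?thesis by (rule all)
qed

text \<open>
  Splitting off finitely many terms replaces \<open>v\<close> by \<open>v + N\<close>, whose real part is large. Terms with
  \<open>j + v = 0\<close> do no harm: under the convention \<open>0 powr s = 0\<close> they are \<open>0\<close> on both sides.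
\<close>
lemma lerch_continuation_exists:
  "\<exists>g. g holomorphic_on - lerch_cut \<and>
    (\<forall>z. norm z < 1 \<longrightarrow> (\<lambda>j. z ^ j / (of_nat j + v) powr s) sums g z)"
proof -
  obtain N :: nat where N: "2 - Re v < real N"
    using reals_Archimedean2 by blast
  then have "Re (v + of_nat N) > 2" by simp
  from lerch_continuation_all_s[OF this, of s] obtain g where hol: "g holomorphic_on - lerch_cut"
    and "\<forall>z. norm z < 1 \<longrightarrow> (\<lambda>j. (of_nat j + (v + of_nat N)) powr (- s) * z ^ j) sums g z"
    by (elim exE conjE)
  then have sums: "(\<lambda>j. (of_nat j + (v + of_nat N)) powr (- s) * z ^ j) sums g z"
    if "norm z < 1" for z
    using that by blast
  let ?h = "\<lambda>z. (\<Sum>j<N. z ^ j / (of_nat j + v) powr s) + z ^ N * g z"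
  have "(\<lambda>j. z ^ j / (of_nat j + v) powr s) sums ?h z" if z: "norm z < 1" for z
  proof -
    have "(\<lambda>j. z ^ N * ((of_nat j + (v + of_nat N)) powr (- s) * z ^ j)) sums (z ^ N * g z)"
      by (rule sums_mult[OF sums[OF z]])
    then have "(\<lambda>j. z ^ (j + N) / (of_nat (j + N) + v) powr s) sums (z ^ N * g z)"
      by (simp add: powr_minus divide_inverse power_add add_ac mult_ac)
    then show ?thesis
      by (subst (asm) sums_iff_shift) (simp add: add.commute)
  qed
  moreover have "?h holomorphic_on - lerch_cut"
    unfolding divide_inverse by (intro holomorphic_intros hol)
  ultimately show ?thesis by blast
qed

section \<open>The remainder of the binomial expansion at infinity\<close>

lemma powr_mult_Re_pos:
  fixes x y s :: complex
  assumes "Re x > 0" "Re y > 0"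
  shows "(x * y) powr s = x powr s * y powr s"
proof -
  have nz: "x \<noteq> 0" "y \<noteq> 0" using assms by auto
  have "\<bar>Im (Ln x)\<bar> < pi / 2" "\<bar>Im (Ln y)\<bar> < pi / 2"
    using assms nz Re_Ln_pos_lt by auto
  then have "Ln (x * y) = Ln x + Ln y"
    using nz by (intro Ln_times_simple) auto
  then show ?thesis
    using nz by (simp add: powr_def ring_distribs exp_add)
qed

lemma norm_powr_le:
  "norm (x powr (- s)) \<le> norm x powr (- Re s) * exp (pi * norm s)"
proof -
  have "Im s * Arg x \<le> \<bar>Im s * Arg x\<bar>" by simp
  also have "\<dots> \<le> norm s * pi"
    unfolding abs_mult using Arg_bounded[of x]
    by (intro mult_mono abs_Im_le_cmod) auto
  finally have "exp (Im s * Arg x) \<le> exp (pi * norm s)"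
    by (simp add: mult.commute)
  then show ?thesis
    by (simp add: norm_powr_complex mult_left_mono)
qed

lemma norm_pochhammer_le:
  fixes s :: complex
  assumes "norm s \<le> B"
  shows "norm (pochhammer s n) \<le> pochhammer B n"
proof -
  have "norm (s + of_nat i) \<le> B + real i" for i
    using norm_triangle_ineq[of s "of_nat i"] assms by simp
  then show ?thesis
    by (induction n)
       (auto simp: pochhammer_Suc norm_mult intro!: mult_mono elim: order_trans[OF norm_ge_zero])
qed

text \<open>
  The remainder of the binomial expansion of \<open>(x + 1) powr (- s)\<close> in descending powers of \<open>x\<close>, to
  be evaluated at \<open>x = j + v\<close>.
\<close>
definition shift_remainder :: "nat \<Rightarrow> complex \<Rightarrow> complex \<Rightarrow> complex" where
  "shift_remainder N s x =
     (x + 1) powr (- s) - (\<Sum>i<N. (- s gchoose i) * x powr (- s - of_nat i))"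

text \<open>
  The binomial series of \<open>(1 + 1/x) powr (- s)\<close>, cut off at \<open>N\<close>, is dominated termwise for
  \<open>norm x \<ge> 2\<close> and \<open>norm s \<le> B\<close> by \<open>(2 / norm x)\<^sup>N\<close> times the one
  of \<open>(1 - 1/2) powr (- B)\<close>. The point is that the constant is uniform in \<open>s\<close>, which yields locally uniform convergence of the remainder series below.
\<close>
lemma shift_remainder_bound:
  fixes B :: real
  shows "\<exists>K. \<forall>s x. norm s \<le> B \<longrightarrow> Re x \<ge> 2 \<longrightarrow>
    norm (shift_remainder N s x) \<le> K * norm x powr (- Re s - real N)"
proof -
  let ?b = "\<lambda>i. pochhammer B i / fact i * (1 / 2) ^ i :: real"
  have "summable ?b"
  proof -
    have "summable (\<lambda>i. (- B gchoose i) * (- 1 / 2) ^ i)"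
      using gen_binomial_real[of "- 1 / 2" "- B"] by (simp add: sums_iff)
    moreover have "(- B gchoose i) * (- 1 / 2) ^ i = ?b i" for i
      using power_mult_distrib[of "- 1 :: real" "- 1 / 2" i] by (simp add: gbinomial_pochhammer)
    ultimately show ?thesis by (simp only:)
  qed
  then have sum_tail: "summable (\<lambda>i. ?b (i + N))"
    by (subst summable_iff_shift)
  define C where "C = (\<Sum>i. ?b (i + N))"
  have "norm (shift_remainder N s x) \<le> exp (pi * B) * 2 ^ N * C * norm x powr (- Re s - real N)"
    if s: "norm s \<le> B" and x: "Re x \<ge> 2" for s x
  proof -
    have nx: "norm x \<ge> 2" using complex_Re_le_cmod[of x] x by linarith
    then have x0: "x \<noteq> 0" by auto
    let ?a = "\<lambda>i. (- s gchoose i) * (1 / x) ^ i"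
    have small: "norm (1 / x) < 1" using nx x0 by (simp add: norm_divide field_simps)
    have "Re (1 + 1 / x) > 0"
    proof -
      have "\<bar>Re (1 / x)\<bar> < 1" using abs_Re_le_cmod[of "1 / x"] small by linarith
      then show ?thesis by simp
    qed
    moreover have "x + 1 = x * (1 + 1 / x)" using x0 by (simp add: field_simps)
    ultimately have prod: "(x + 1) powr (- s) = x powr (- s) * (1 + 1 / x) powr (- s)"
      using powr_mult_Re_pos[of x "1 + 1 / x" "- s"] x by simp
    have fin: "(\<Sum>i<N. (- s gchoose i) * x powr (- s - of_nat i)) = x powr (- s) * (\<Sum>i<N. ?a i)"
      using x0 by (simp add: sum_distrib_left powr_diff power_divide mult_ac)
    have sums: "?a sums (1 + 1 / x) powr (- s)"
      by (rule gen_binomial_complex[OF small])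
    have tail: "(\<lambda>i. ?a (i + N)) sums ((1 + 1 / x) powr (- s) - (\<Sum>i<N. ?a i))"
      by (subst sums_iff_shift) (use sums in simp)
    have rem: "shift_remainder N s x = x powr (- s) * (\<Sum>i. ?a (i + N))"
      unfolding shift_remainder_def prod fin using tail by (simp add: sums_iff right_diff_distrib)
    have le: "norm (?a (i + N)) \<le> (2 / norm x) ^ N * ?b (i + N)" for i
    proof -
      have "norm (?a (i + N)) = norm (pochhammer s (i + N)) / fact (i + N) * (1 / norm x) ^ (i + N)"
        by (simp add: gbinomial_pochhammer norm_mult norm_divide norm_power)
      also have "\<dots> \<le> pochhammer B (i + N) / fact (i + N) * ((1 / norm x) ^ N * (1 / 2) ^ i)"
      proof (intro mult_mono divide_right_mono norm_pochhammer_le s)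
        have "(1 / norm x) ^ i \<le> (1 / 2) ^ i"
          using nx x0 by (intro power_mono) (auto simp: divide_le_eq)
        then show "(1 / norm x) ^ (i + N) \<le> (1 / norm x) ^ N * (1 / 2) ^ i"
          unfolding power_add by (subst mult.commute) (intro mult_left_mono; simp)
      qed (use order_trans[OF norm_ge_zero norm_pochhammer_le[OF s]] in auto)
      also have "\<dots> = (2 / norm x) ^ N * ?b (i + N)"
        by (simp add: power_add power_divide field_simps)
      finally show ?thesis .
    qed
    have "norm (\<Sum>i. ?a (i + N)) \<le> (\<Sum>i. (2 / norm x) ^ N * ?b (i + N))"
      by (rule norm_suminf_le[OF le summable_mult[OF sum_tail]])
    also have "\<dots> = (2 / norm x) ^ N * C"
      unfolding C_def by (rule suminf_mult[OF sum_tail])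
    finally have sumle: "norm (\<Sum>i. ?a (i + N)) \<le> (2 / norm x) ^ N * C" .
    have "norm (x powr (- s)) \<le> norm x powr (- Re s) * exp (pi * B)"
      by (rule order_trans[OF norm_powr_le mult_left_mono]) (use s in auto)
    then have "norm (shift_remainder N s x)
        \<le> (norm x powr (- Re s) * exp (pi * B)) * ((2 / norm x) ^ N * C)"
      unfolding rem norm_mult using sumle by (intro mult_mono) auto
    also have "\<dots> = exp (pi * B) * 2 ^ N * C * norm x powr (- Re s - real N)"
      using x0 by (simp add: powr_diff powr_realpow power_divide)
    finally show ?thesis .
  qed
  then show ?thesis by blast
qed

definition remainder_series :: "nat \<Rightarrow> complex \<Rightarrow> complex \<Rightarrow> complex \<Rightarrow> complex" where
  "remainder_series N z s v = (\<Sum>j. z ^ j * shift_remainder N s (of_nat j + v))"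

lemma remainder_series_dominated:
  assumes v: "Re v \<ge> 2" and \<sigma>: "\<sigma> > 1 - real N"
  obtains M :: "nat \<Rightarrow> real" where "summable M"
    "\<And>j z s. norm z \<le> 1 \<Longrightarrow> norm s \<le> B \<Longrightarrow> Re s \<ge> \<sigma> \<Longrightarrow>
      norm (z ^ j * shift_remainder N s (of_nat j + v)) \<le> M j"
proof -
  obtain K where K: "\<And>s x. norm s \<le> B \<Longrightarrow> Re x \<ge> 2 \<Longrightarrow>
      norm (shift_remainder N s x) \<le> K * norm x powr (- Re s - real N)"
    using shift_remainder_bound[of B N] by blast
  have "summable (\<lambda>j. real (Suc j) powr (- \<sigma> - real N))"
    using \<sigma> summable_real_powr_iff[of "- \<sigma> - real N"] by (subst summable_Suc_iff) simp
  then have "summable (\<lambda>j. \<bar>K\<bar> * real (Suc j) powr (- \<sigma> - real N))"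
    by (rule summable_mult)
  moreover have "norm (z ^ j * shift_remainder N s (of_nat j + v))
      \<le> \<bar>K\<bar> * real (Suc j) powr (- \<sigma> - real N)"
    if z: "norm z \<le> 1" and s: "norm s \<le> B" "Re s \<ge> \<sigma>" for j z s
  proof -
    let ?x = "of_nat j + v"
    have nx: "norm ?x \<ge> real (Suc j)" using complex_Re_le_cmod[of ?x] v by simp
    have "norm (z ^ j * shift_remainder N s ?x) \<le> 1 * norm (shift_remainder N s ?x)"
      unfolding norm_mult norm_power using z by (intro mult_right_mono power_le_one) auto
    also have "\<dots> \<le> K * norm ?x powr (- Re s - real N)"
      using K[of s ?x] s v by simp
    also have "\<dots> \<le> \<bar>K\<bar> * norm ?x powr (- Re s - real N)"
      by (intro mult_right_mono) auto
    also have "norm ?x powr (- Re s - real N) \<le> norm ?x powr (- \<sigma> - real N)"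
      using nx s by (intro powr_mono) auto
    also have "norm ?x powr (- \<sigma> - real N) \<le> real (Suc j) powr (- \<sigma> - real N)"
      using nx \<sigma> by (intro powr_mono2') auto
    finally show ?thesis by (simp add: mult_left_mono)
  qed
  ultimately show ?thesis by (rule that)
qed

lemma remainder_series_summable:
  assumes "Re v \<ge> 2" "Re s > 1 - real N" "norm z \<le> 1"
  shows "summable (\<lambda>j. z ^ j * shift_remainder N s (of_nat j + v))"
proof -
  obtain M where M: "summable M" "\<And>j z s'. norm z \<le> 1 \<Longrightarrow> norm s' \<le> norm s \<Longrightarrow> Re s' \<ge> Re s \<Longrightarrow>
      norm (z ^ j * shift_remainder N s' (of_nat j + v)) \<le> M j"
    using remainder_series_dominated[OF assms(1,2), of "norm s"] by blast
  show ?thesis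
    by (rule summable_comparison_test'[OF M(1), of 0]) (use M(2) assms in auto)
qed

lemma remainder_series_continuous_z:
  assumes "Re v \<ge> 2" "Re s > 1 - real N"
  shows "continuous_on (cball 0 1) (\<lambda>z. remainder_series N z s v)"
proof -
  obtain M where M: "summable M" "\<And>j z s'. norm z \<le> 1 \<Longrightarrow> norm s' \<le> norm s \<Longrightarrow> Re s' \<ge> Re s \<Longrightarrow>
      norm (z ^ j * shift_remainder N s' (of_nat j + v)) \<le> M j"
    using remainder_series_dominated[OF assms, of "norm s"] by blast
  show ?thesis
    unfolding remainder_series_def
  proof (rule uniform_limit_theorem)
    show "uniform_limit (cball 0 1) (\<lambda>n z. \<Sum>j<n. z ^ j * shift_remainder N s (of_nat j + v))
        (\<lambda>z. \<Sum>j. z ^ j * shift_remainder N s (of_nat j + v)) sequentially"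
      by (rule Weierstrass_m_test[OF M(2) M(1)]) auto
  qed (auto intro!: always_eventually continuous_intros)
qed

lemma remainder_series_holomorphic_s:
  assumes v: "Re v \<ge> 2" and z: "norm z \<le> 1"
  shows "(\<lambda>s. remainder_series N z s v) holomorphic_on {s. Re s > 1 - real N}"
  unfolding remainder_series_def
proof (rule holomorphic_uniform_sequence)
  show "open {s. Re s > 1 - real N}"
    by (rule open_halfspace_Re_gt)
  have nz: "of_nat j + v \<noteq> 0" "of_nat j + v + 1 \<noteq> 0" for j
    using v by (auto simp: complex_eq_iff)
  show "(\<lambda>s. \<Sum>j<n. z ^ j * shift_remainder N s (of_nat j + v)) holomorphic_on {s. Re s > 1 - real N}" for n
    unfolding shift_remainder_def gbinomial_pochhammer
    by (intro holomorphic_intros nz) auto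
  fix s0 assume s0: "s0 \<in> {s. Re s > 1 - real N}"
  define d where "d = (Re s0 - (1 - real N)) / 2"
  have d: "d > 0" "Re s0 - d > 1 - real N"
    using s0 by (auto simp: d_def field_simps)
  have Re: "Re s \<ge> Re s0 - d" if "s \<in> cball s0 d" for s
    using that abs_Re_le_cmod[of "s0 - s"] by (auto simp: dist_norm)
  have nrm: "norm s \<le> norm s0 + d" if "s \<in> cball s0 d" for s
    using that norm_triangle_ineq2[of s s0] by (auto simp: dist_norm norm_minus_commute)
  obtain M where M: "summable M" "\<And>j z s. norm z \<le> 1 \<Longrightarrow> norm s \<le> norm s0 + d \<Longrightarrow> Re s \<ge> Re s0 - d \<Longrightarrow>
      norm (z ^ j * shift_remainder N s (of_nat j + v)) \<le> M j"
    using remainder_series_dominated[OF v d(2), of "norm s0 + d"] by blast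
  have "uniform_limit (cball s0 d) (\<lambda>n s. \<Sum>j<n. z ^ j * shift_remainder N s (of_nat j + v))
      (\<lambda>s. \<Sum>j. z ^ j * shift_remainder N s (of_nat j + v)) sequentially"
    by (rule Weierstrass_m_test[OF M(2) M(1)]) (use z Re nrm in auto)
  moreover have "cball s0 d \<subseteq> {s. Re s > 1 - real N}"
    using Re d by (auto intro: less_le_trans)
  ultimately show "\<exists>d>0. cball s0 d \<subseteq> {s. Re s > 1 - real N} \<and>
      uniform_limit (cball s0 d) (\<lambda>n s. \<Sum>j<n. z ^ j * shift_remainder N s (of_nat j + v))
      (\<lambda>s. \<Sum>j. z ^ j * shift_remainder N s (of_nat j + v)) sequentially"
    using d by blast
qed


section \<open>Continuation in the exponent on the unit circle\<close>

definition lerch_convergent :: "complex \<Rightarrow> complex \<Rightarrow> bool" where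
  "lerch_convergent z s \<longleftrightarrow> norm z < 1 \<or> norm z = 1 \<and> Re s > 1"

lemma lerch_convergent_add: "lerch_convergent z s \<Longrightarrow> lerch_convergent z (s + of_nat i)"
  by (auto simp: lerch_convergent_def)

lemma lerch_series_summable:
  assumes "lerch_convergent z s"
  shows "summable (\<lambda>j. z ^ j / (of_nat j + v) powr s)"
proof (cases "norm z < 1")
  case True
  then show ?thesis
    using lerch_continuation_exists[of v s] by (blast dest: sums_summable)
next
  case False
  with assms have z: "norm z \<le> 1" and s: "Re s > 1"
    by (auto simp: lerch_convergent_def)
  obtain K :: nat where K: "2 - Re v < real K"
    using reals_Archimedean2 by blast
  have "summable (\<lambda>j. z ^ j * shift_remainder 0 s (of_nat j + (v + of_nat K)))"
    using K s z by (intro remainder_series_summable) auto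
  then have "summable (\<lambda>j. z ^ Suc K * (z ^ j * shift_remainder 0 s (of_nat j + (v + of_nat K))))"
    by (rule summable_mult)
  then have "summable (\<lambda>j. z ^ (j + Suc K) / (of_nat (j + Suc K) + v) powr s)"
    by (simp add: shift_remainder_def powr_minus divide_inverse power_add add_ac mult_ac)
  then show ?thesis
    by (subst (asm) summable_iff_shift)
qed

lemma lerch_series_sums:
  "lerch_convergent z s \<Longrightarrow> (\<lambda>j. z ^ j / (of_nat j + v) powr s) sums lerch_series z s v"
  unfolding lerch_series_def by (intro summable_sums lerch_series_summable)

lemma lerch_series_split:
  assumes "lerch_convergent z s"
  shows "lerch_series z s v =
    (\<Sum>j<K. z ^ j / (of_nat j + v) powr s) + z ^ K * lerch_series z s (v + of_nat K)"
proof -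
  have "(\<lambda>j. z ^ K * (z ^ j / (of_nat j + (v + of_nat K)) powr s)) sums (z ^ K * lerch_series z s (v + of_nat K))"
    by (intro sums_mult lerch_series_sums assms)
  then have "(\<lambda>j. z ^ (j + K) / (of_nat (j + K) + v) powr s) sums (z ^ K * lerch_series z s (v + of_nat K))"
    by (simp add: power_add add_ac mult_ac)
  then have "(\<lambda>j. z ^ j / (of_nat j + v) powr s) sums
      (z ^ K * lerch_series z s (v + of_nat K) + (\<Sum>j<K. z ^ j / (of_nat j + v) powr s))"
    by (subst (asm) sums_iff_shift)
  from sums_unique2[OF lerch_series_sums[OF assms] this] show ?thesis
    by (simp add: add.commute)
qed

text \<open>
  Expanding each difference \<open>(x + 1) powr (- s) - x powr (- s)\<close> at \<open>x = j + v\<close> and summing over \<open>j\<close>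
  turns the powers \<open>x powr (- s - i)\<close> into Lerch series at \<open>s + i\<close>. The series at \<open>s\<close> itself cancels, so
  that the formula also holds where only the series at \<open>s + 1, s + 2, \<dots>\<close> converge.
\<close>
lemma shift_difference_sums:
  assumes v: "Re v \<ge> 2" and z: "norm z \<le> 1" and s: "Re s > 1 - real N" and N: "N \<ge> 1"
    and conv: "\<And>i. i \<in> {1..<N} \<Longrightarrow> lerch_convergent z (s + of_nat i)"
  shows "(\<lambda>j. z ^ j * ((of_nat j + v + 1) powr (- s) - (of_nat j + v) powr (- s))) sums
    ((\<Sum>i=1..<N. (- s gchoose i) * lerch_series z (s + of_nat i) v) + remainder_series N z s v)"
proof -
  have "(\<lambda>j. \<Sum>i=1..<N. (- s gchoose i) * (z ^ j / (of_nat j + v) powr (s + of_nat i))) sums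
      (\<Sum>i=1..<N. (- s gchoose i) * lerch_series z (s + of_nat i) v)"
    by (intro sums_sum sums_mult lerch_series_sums conv)
  moreover have "(\<lambda>j. z ^ j * shift_remainder N s (of_nat j + v)) sums remainder_series N z s v"
    unfolding remainder_series_def by (intro summable_sums remainder_series_summable v z s)
  ultimately have "(\<lambda>j. (\<Sum>i=1..<N. (- s gchoose i) * (z ^ j / (of_nat j + v) powr (s + of_nat i))) +
      z ^ j * shift_remainder N s (of_nat j + v)) sums
    ((\<Sum>i=1..<N. (- s gchoose i) * lerch_series z (s + of_nat i) v) + remainder_series N z s v)"
    by (rule sums_add)
  moreover have "(\<Sum>i=1..<N. (- s gchoose i) * (z ^ j / x powr (s + of_nat i))) + z ^ j * shift_remainder N s x
      = z ^ j * ((x + 1) powr (- s) - x powr (- s))" for j x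
  proof -
    have "{..<N} = insert 0 {1..<N}" using N by auto
    then have "(\<Sum>i<N. (- s gchoose i) * x powr (- s - of_nat i))
        = x powr (- s) + (\<Sum>i=1..<N. (- s gchoose i) * x powr (- s - of_nat i))" by simp
    moreover have "(\<Sum>i=1..<N. (- s gchoose i) * (z ^ j / x powr (s + of_nat i)))
        = z ^ j * (\<Sum>i=1..<N. (- s gchoose i) * x powr (- s - of_nat i))"
    proof -
      have "x powr (- s - of_nat i) = 1 / x powr (s + of_nat i)" for i
        using powr_minus_divide[of x "s + of_nat i"] by simp
      then show ?thesis by (simp add: sum_distrib_left mult_ac)
    qed
    ultimately show ?thesis
      by (simp add: shift_remainder_def algebra_simps)
  qed
  ultimately show ?thesis by simp
qed

text \<open>
  Comparing the series with its shift by one index gives \<open>1 - z\<close> times the series in terms of the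
  differences just expanded. Besides the remainder, the right-hand side only involves values
  at \<open>s + 1, s + 2, \<dots>\<close>, which are further to the right.
\<close>
lemma lerch_series_recurrence:
  assumes v: "Re v \<ge> 2" and s: "Re s > 1 - real N" and N: "N \<ge> 1" and conv: "lerch_convergent z s"
  shows "(1 - z) * lerch_series z s v = v powr (- s) +
    z * ((\<Sum>i=1..<N. (- s gchoose i) * lerch_series z (s + of_nat i) v) + remainder_series N z s v)"
    (is "_ = _ + z * ?X")
proof -
  have z: "norm z \<le> 1" using conv by (auto simp: lerch_convergent_def)
  have "(\<lambda>j. z ^ j * ((of_nat j + v + 1) powr (- s) - (of_nat j + v) powr (- s))) sums ?X"
    by (rule shift_difference_sums[OF v z s N lerch_convergent_add[OF conv]])
  from sums_add[OF sums_mult[OF this, of z] sums_mult[OF lerch_series_sums[OF conv], of z v]]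
  have "(\<lambda>j. z * z ^ j * (of_nat j + v + 1) powr (- s)) sums (z * ?X + z * lerch_series z s v)"
    by (simp add: powr_minus divide_inverse algebra_simps)
  then have "(\<lambda>j. z ^ Suc j / (of_nat (Suc j) + v) powr s) sums (z * ?X + z * lerch_series z s v)"
    by (simp add: powr_minus divide_inverse algebra_simps)
  then have "(\<lambda>j. z ^ j / (of_nat j + v) powr s) sums (z * ?X + z * lerch_series z s v + 1 / v powr s)"
    by (subst (asm) sums_Suc_iff) simp
  from sums_unique2[OF lerch_series_sums[OF conv] this] show ?thesis
    by (simp add: powr_minus divide_inverse algebra_simps)
qed

text \<open>
  The recurrence, divided by \<open>1 - z\<close>, extends the values at the points \<open>z \<noteq> 1\<close> of the closed disc to the
  left in \<open>s\<close>, one strip of width one at a time. Continuity in \<open>z\<close> is carried along because it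
  identifies the values on the circle with those of the branch continued in \<open>z\<close>, while holomorphy in \<open>s\<close>
  is what the argument at the branch point needs.
\<close>
lemma lerch_circle_extension_large:
  assumes v: "Re v \<ge> 2"
  shows "\<exists>L. (\<forall>s. Re s > 1 - real N \<longrightarrow> continuous_on (cball 0 1 - {1}) (\<lambda>z. L z s)) \<and>
    (\<forall>z\<in>cball 0 1 - {1}. L z holomorphic_on {s. Re s > 1 - real N}) \<and>
    (\<forall>s z. Re s > 1 - real N \<longrightarrow> z \<noteq> 1 \<longrightarrow> lerch_convergent z s \<longrightarrow> L z s = lerch_series z s v)"
proof (induction N)
  case 0
  have v0: "v \<noteq> 0" using v by auto
  let ?L = "\<lambda>z s. v powr (- s) + z * remainder_series 0 z s v"
  have "?L z s = lerch_series z s v" if s: "Re s > 1" and conv: "lerch_convergent z s" for z s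
  proof -
    have z: "norm z \<le> 1" using conv by (auto simp: lerch_convergent_def)
    have "remainder_series 0 z s v = lerch_series z s (v + of_nat 1)"
      unfolding remainder_series_def lerch_series_def shift_remainder_def
      by (simp add: powr_minus divide_inverse add_ac)
    then show ?thesis
      using lerch_series_split[OF conv, of v 1] by (simp add: powr_minus divide_inverse)
  qed
  moreover have "continuous_on (cball 0 1 - {1}) (\<lambda>z. ?L z s)" if "Re s > 1" for s
    using remainder_series_continuous_z[OF v, of 0 s] that
    by (intro continuous_intros) (auto elim: continuous_on_subset)
  moreover have "?L z holomorphic_on {s. Re s > 1}" if "z \<in> cball 0 1 - {1}" for z
    using remainder_series_holomorphic_s[OF v, of z 0] that v0
    by (intro holomorphic_intros) auto
  ultimately show ?case by (intro exI[of _ ?L]) auto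
next
  case (Suc N)
  then obtain L where cont: "\<And>s. Re s > 1 - real N \<Longrightarrow> continuous_on (cball 0 1 - {1}) (\<lambda>z. L z s)"
    and hol: "\<And>z. z \<in> cball 0 1 - {1} \<Longrightarrow> L z holomorphic_on {s. Re s > 1 - real N}"
    and eq: "\<And>s z. Re s > 1 - real N \<Longrightarrow> z \<noteq> 1 \<Longrightarrow> lerch_convergent z s \<Longrightarrow> L z s = lerch_series z s v"
    by blast
  have v0: "v \<noteq> 0" using v by auto
  let ?S = "{s. Re s > 1 - real (Suc N)}"
  let ?L = "\<lambda>z s. (v powr (- s) + z * ((\<Sum>i=1..<Suc N. (- s gchoose i) * L z (s + of_nat i))
      + remainder_series (Suc N) z s v)) / (1 - z)"
  have "?L z s = lerch_series z s v" if s: "s \<in> ?S" and z: "z \<noteq> 1" and conv: "lerch_convergent z s" for z s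
  proof -
    have "L z (s + of_nat i) = lerch_series z (s + of_nat i) v" if "i \<in> {1..<Suc N}" for i
      using that s by (intro eq z lerch_convergent_add conv) auto
    then have "?L z s = (1 - z) * lerch_series z s v / (1 - z)"
      using lerch_series_recurrence[OF v, of "Suc N" s z] s conv by simp
    then show ?thesis using z by simp
  qed
  moreover have "continuous_on (cball 0 1 - {1}) (\<lambda>z. ?L z s)" if s: "s \<in> ?S" for s
  proof -
    have "continuous_on (cball 0 1 - {1}) (\<lambda>z. remainder_series (Suc N) z s v)"
      using remainder_series_continuous_z[OF v, of "Suc N" s] s by (auto elim: continuous_on_subset)
    moreover have "continuous_on (cball 0 1 - {1}) (\<lambda>z. L z (s + of_nat i))" if "i \<in> {1..<Suc N}" for i
      using s that by (intro cont) auto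
    ultimately show ?thesis by (intro continuous_intros) auto
  qed
  moreover have "?L z holomorphic_on ?S" if z: "z \<in> cball 0 1 - {1}" for z
  proof -
    have "(\<lambda>s. remainder_series (Suc N) z s v) holomorphic_on ?S"
      using remainder_series_holomorphic_s[OF v, of z "Suc N"] z by auto
    moreover have "(\<lambda>s. L z (s + of_nat i)) holomorphic_on ?S" if "i \<in> {1..<Suc N}" for i
    proof -
      have "(L z \<circ> (\<lambda>s. s + of_nat i)) holomorphic_on ?S"
        by (rule holomorphic_on_compose_gen[OF _ hol[OF z]]) (use that in \<open>auto intro!: holomorphic_intros\<close>)
      then show ?thesis by (simp add: o_def)
    qed
    ultimately show ?thesis
      unfolding gbinomial_pochhammer using v0 z by (intro holomorphic_intros) auto
  qed
  ultimately show ?case by (intro exI[of _ ?L]) auto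
qed

text \<open>
  At \<open>z = 1\<close> the factor \<open>1 - z\<close> vanishes and the recurrence says nothing about \<open>\<zeta>(s,v)\<close>. Taken
  at \<open>s - 1\<close> instead of \<open>s\<close>, the sum of the differences telescopes to \<open>- v powr (1 - s)\<close>, and the first term
  of the expansion is \<open>(1 - s) \<zeta>(s,v)\<close>. The statement is about \<open>(s - 1) \<zeta>(s,v)\<close>
  because the binomial coefficients cancel exactly the poles of the terms \<open>\<zeta>(s + i - 1,v)\<close>.
\<close>
lemma hurwitz_zeta_extension_large:
  assumes v: "Re v \<ge> 2"
  shows "\<exists>h. h holomorphic_on {s. Re s > 1 - real N} \<and>
    (\<forall>s. Re s > 1 \<longrightarrow> h s = (s - 1) * lerch_series 1 s v)"
proof (induction N)
  case 0
  have v0: "v \<noteq> 0" using v by auto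
  let ?h = "\<lambda>s. (s - 1) * (v powr (- s) + remainder_series 0 1 s v)"
  have "?h s = (s - 1) * lerch_series 1 s v" if s: "Re s > 1" for s
  proof -
    have "lerch_convergent 1 s" using s by (simp add: lerch_convergent_def)
    moreover have "remainder_series 0 1 s v = lerch_series 1 s (v + of_nat 1)"
      unfolding remainder_series_def lerch_series_def shift_remainder_def
      by (simp add: powr_minus divide_inverse add_ac)
    ultimately show ?thesis
      using lerch_series_split[of 1 s v 1] by (simp add: powr_minus divide_inverse)
  qed
  moreover have "?h holomorphic_on {s. Re s > 1}"
    using remainder_series_holomorphic_s[OF v, of 1 0] v0 by (intro holomorphic_intros) auto
  ultimately show ?case by (intro exI[of _ ?h]) auto
next
  case (Suc N)
  then obtain h where hol: "h holomorphic_on {s. Re s > 1 - real N}"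
    and eq: "\<And>s. Re s > 1 \<Longrightarrow> h s = (s - 1) * lerch_series 1 s v" by blast
  have v0: "v \<noteq> 0" using v by auto
  \<comment> \<open>The remainder series at \<open>s - 1\<close> converges for \<open>Re s > 2 - M\<close>, which is the half-plane wanted.\<close>
  define M where "M = N + 2"
  let ?S = "{s. Re s > 1 - real (Suc N)}"
  let ?h = "\<lambda>s. v powr (1 - s) - (\<Sum>i=2..<M. (1 - s gchoose (i - 1)) / of_nat i * h (s + of_nat (i - 1)))
      + remainder_series M 1 (s - 1) v"
  have "?h s = (s - 1) * lerch_series 1 s v" if s: "Re s > 1" for s
  proof -
    let ?Z = "\<lambda>i. lerch_series 1 (s - 1 + of_nat i) v"
    have "(\<lambda>j. 1 ^ j * ((of_nat j + v + 1) powr (- (s - 1)) - (of_nat j + v) powr (- (s - 1)))) sums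
        ((\<Sum>i=1..<M. (- (s - 1) gchoose i) * ?Z i) + remainder_series M 1 (s - 1) v)"
      by (rule shift_difference_sums[OF v]) (use s in \<open>auto simp: M_def lerch_convergent_def\<close>)
    moreover have "(\<lambda>j. 1 ^ j * ((of_nat j + v + 1) powr (- (s - 1)) - (of_nat j + v) powr (- (s - 1))))
        sums (0 - v powr (- (s - 1)))"
    proof -
      have "(\<lambda>j. (of_nat j + v) powr (- (s - 1))) \<longlonglongrightarrow> 0"
      proof (rule Lim_null_comparison)
        show "\<forall>\<^sub>F j in sequentially. norm ((of_nat j + v) powr (- (s - 1)))
            \<le> real j powr (- Re (s - 1)) * exp (pi * norm (s - 1))"
        proof (rule eventually_sequentiallyI[of 1])
          fix j :: nat assume j: "1 \<le> j"
          have "real j \<le> norm (of_nat j + v)"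
            using complex_Re_le_cmod[of "of_nat j + v"] v by simp
          then have "norm (of_nat j + v) powr (- Re (s - 1)) \<le> real j powr (- Re (s - 1))"
            using s j by (intro powr_mono2') auto
          then show "norm ((of_nat j + v) powr (- (s - 1))) \<le> real j powr (- Re (s - 1)) * exp (pi * norm (s - 1))"
            using norm_powr_le[of "of_nat j + v" "s - 1"] by (meson exp_ge_zero mult_right_mono order_trans)
        qed
        have "(\<lambda>j. real j powr (- Re (s - 1))) \<longlonglongrightarrow> 0"
          using s by (intro tendsto_neg_powr filterlim_real_sequentially) auto
        from tendsto_mult_left_zero[OF this]
        show "(\<lambda>j. real j powr (- Re (s - 1)) * exp (pi * norm (s - 1))) \<longlonglongrightarrow> 0" .
      qed
      from telescope_sums[OF this] show ?thesis
        by (simp add: add_ac)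
    qed
    ultimately have "(\<Sum>i=1..<M. (- (s - 1) gchoose i) * ?Z i) + remainder_series M 1 (s - 1) v
        = - (v powr (1 - s))"
      using sums_unique2 by fastforce
    \<comment> \<open>The term \<open>i = 1\<close> is the one to solve for.\<close>
    moreover have "{1..<M} = insert 1 {2..<M}" by (auto simp: M_def)
    ultimately have rec: "(s - 1) * lerch_series 1 s v = v powr (1 - s) +
        (\<Sum>i=2..<M. (1 - s gchoose i) * ?Z i) + remainder_series M 1 (s - 1) v"
      by (simp add: algebra_simps)
    have "(1 - s gchoose i) * ?Z i = - ((1 - s gchoose (i - 1)) / of_nat i * h (s + of_nat (i - 1)))"
      if "i \<in> {2..<M}" for i
    proof -
      obtain k where k: "i = Suc k" "k \<ge> 1" using \<open>i \<in> _\<close> by (cases i) auto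
      have h_eq: "h (s + of_nat k) = (s + of_nat k - 1) * ?Z i"
        using s by (subst eq) (auto simp: k)
      have step: "of_nat i * (1 - s gchoose i) = (1 - s - of_nat k) * (1 - s gchoose k)"
        using gbinomial_absorb_comp[of "1 - s" k] gbinomial_absorption[of k "1 - s"] unfolding k
        by simp
      have "(1 - s gchoose k) * h (s + of_nat k) = - ((1 - s - of_nat k) * (1 - s gchoose k) * ?Z i)"
        unfolding h_eq by (simp add: algebra_simps)
      also have "\<dots> = - (of_nat i * (1 - s gchoose i) * ?Z i)"
        unfolding step by simp
      finally show ?thesis
        using k by (simp add: eq_divide_eq del: of_nat_Suc)
    qed
    then show ?thesis unfolding rec by (simp add: sum_negf)
  qed
  moreover have "?h holomorphic_on ?S"
  proof -
    have "(\<lambda>s. remainder_series M 1 (s - 1) v) holomorphic_on ?S"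
    proof -
      have "((\<lambda>s. remainder_series M 1 s v) \<circ> (\<lambda>s. s - 1)) holomorphic_on ?S"
        by (rule holomorphic_on_compose_gen[OF _ remainder_series_holomorphic_s[OF v]])
           (auto intro!: holomorphic_intros simp: M_def)
      then show ?thesis by (simp add: o_def)
    qed
    moreover have "(\<lambda>s. h (s + of_nat (i - 1))) holomorphic_on ?S" if "i \<in> {2..<M}" for i
    proof -
      have "(h \<circ> (\<lambda>s. s + of_nat (i - 1))) holomorphic_on ?S"
        by (rule holomorphic_on_compose_gen[OF _ hol]) (use that in \<open>auto intro!: holomorphic_intros\<close>)
      then show ?thesis by (simp add: o_def)
    qed
    ultimately show ?thesis
      unfolding gbinomial_pochhammer using v0 by (intro holomorphic_intros) auto
  qed
  ultimately show ?case by (intro exI[of _ ?h]) auto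
qed

lemma holomorphic_lerch_term: "(\<lambda>s. z ^ j / (c :: complex) powr s) holomorphic_on A"
proof (cases "c = 0")
  case False
  then show ?thesis by (intro holomorphic_intros) auto
qed simp

lemma lerch_circle_extension:
  "\<exists>L. (\<forall>s. Re s > 1 - real N \<longrightarrow> continuous_on (cball 0 1 - {1}) (\<lambda>z. L z s)) \<and>
    (\<forall>z\<in>cball 0 1 - {1}. L z holomorphic_on {s. Re s > 1 - real N}) \<and>
    (\<forall>s z. Re s > 1 - real N \<longrightarrow> z \<noteq> 1 \<longrightarrow> lerch_convergent z s \<longrightarrow> L z s = lerch_series z s v)"
proof -
  obtain K :: nat where K: "2 - Re v < real K"
    using reals_Archimedean2 by blast
  then have "Re (v + of_nat K) \<ge> 2" by simp
  from lerch_circle_extension_large[OF this, of N] obtain L where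
    cont: "\<And>s. Re s > 1 - real N \<Longrightarrow> continuous_on (cball 0 1 - {1}) (\<lambda>z. L z s)"
    and hol: "\<And>z. z \<in> cball 0 1 - {1} \<Longrightarrow> L z holomorphic_on {s. Re s > 1 - real N}"
    and eq: "\<And>s z. Re s > 1 - real N \<Longrightarrow> z \<noteq> 1 \<Longrightarrow> lerch_convergent z s \<Longrightarrow>
      L z s = lerch_series z s (v + of_nat K)"
    by blast
  let ?L = "\<lambda>z s. (\<Sum>j<K. z ^ j / (of_nat j + v) powr s) + z ^ K * L z s"
  have "continuous_on (cball 0 1 - {1}) (\<lambda>z. ?L z s)" if "Re s > 1 - real N" for s
    unfolding divide_inverse by (intro continuous_intros cont that)
  moreover have "?L z holomorphic_on {s. Re s > 1 - real N}" if "z \<in> cball 0 1 - {1}" for z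
    by (intro holomorphic_intros holomorphic_lerch_term hol that)
  moreover have "?L z s = lerch_series z s v"
    if "Re s > 1 - real N" "z \<noteq> 1" "lerch_convergent z s" for s z
    using eq[OF that] lerch_series_split[OF that(3), of v K] by simp
  ultimately show ?thesis by (intro exI[of _ ?L]) auto
qed

section \<open>Regularity of the principal branch\<close>

text \<open>
  The continuation in \<open>z\<close> is an arbitrarily chosen function with these two properties; that one
  exists is the content of \<open>lerch_continuation_exists\<close>.
\<close>
lemma lerch_branch:
  fixes s v
  defines "G \<equiv> analytic_continuation (\<lambda>z. lerch_series z s v) (ball 0 1) (- lerch_cut)"
  shows lerch_branch_holomorphic: "G holomorphic_on - lerch_cut"
    and lerch_branch_eq_series: "norm z < 1 \<Longrightarrow> G z = lerch_series z s v"
proof -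
  obtain g where g: "g holomorphic_on - lerch_cut"
    "\<And>z. norm z < 1 \<Longrightarrow> (\<lambda>j. z ^ j / (of_nat j + v) powr s) sums g z"
    using lerch_continuation_exists[of v s] by blast
  then have "g z = lerch_series z s v" if "norm z < 1" for z
    using that by (simp add: lerch_series_def sums_iff)
  with g(1) have "\<exists>g. g holomorphic_on - lerch_cut \<and> (\<forall>z\<in>ball 0 1. g z = lerch_series z s v)"
    by auto
  from someI_ex[OF this]
  have "G holomorphic_on - lerch_cut \<and> (\<forall>z\<in>ball 0 1. G z = lerch_series z s v)"
    unfolding G_def analytic_continuation_def .
  then show "G holomorphic_on - lerch_cut" "norm z < 1 \<Longrightarrow> G z = lerch_series z s v"
    by auto
qed

lemma hurwitz_lerch_convergent:
  "lerch_convergent z s \<Longrightarrow> hurwitz_lerch z s v = lerch_series z s v"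
  by (auto simp: hurwitz_lerch_def lerch_convergent_def)

lemma hurwitz_lerch_branch:
  assumes "z \<notin> lerch_cut" "\<not> lerch_convergent z s"
  shows "hurwitz_lerch z s v =
    analytic_continuation (\<lambda>z. lerch_series z s v) (ball 0 1) (- lerch_cut) z"
proof -
  have "z \<noteq> 1" using assms(1) by (auto simp: lerch_cut_iff)
  with assms(2) show ?thesis
    unfolding hurwitz_lerch_def lerch_convergent_def by auto
qed

lemma circle_not_in_lerch_cut:
  assumes "norm z = 1" "z \<noteq> 1"
  shows "z \<notin> lerch_cut"
proof
  assume "z \<in> lerch_cut"
  then obtain t where "z = of_real t" "t \<ge> 1" by (auto simp: lerch_cut_def)
  with assms show False by auto
qed

text \<open>
  Both the branch continued in \<open>z\<close> and \<open>L\<close> are limits, from inside the disc, of the same function.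
\<close>
lemma hurwitz_lerch_eq_circle_extension:
  assumes cont: "continuous_on (cball 0 1 - {1}) L"
    and eq: "\<And>z. norm z < 1 \<Longrightarrow> L z = lerch_series z s v"
    and z: "norm z = 1" "z \<noteq> 1" and s: "\<not> Re s > 1"
  shows "hurwitz_lerch z s v = L z"
proof -
  let ?G = "analytic_continuation (\<lambda>z. lerch_series z s v) (ball 0 1) (- lerch_cut)"
  have cut: "z \<in> - lerch_cut" using circle_not_in_lerch_cut z by auto
  have lim: "z islimpt ball 0 1"
    using z by (simp add: islimpt_ball)
  have "open (- lerch_cut)" using closed_lerch_cut by (simp add: closed_def)
  then have "isCont ?G z"
    using holomorphic_on_imp_continuous_on[OF lerch_branch_holomorphic] cut
    by (simp add: continuous_on_eq_continuous_at)
  then have "(?G \<longlongrightarrow> ?G z) (at z within ball 0 1)"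
    by (auto simp: isCont_def intro: tendsto_within_subset)
  moreover have "eventually (\<lambda>x. ?G x = L x) (at z within ball 0 1)"
    by (simp add: eventually_at_filter lerch_branch_eq_series eq)
  ultimately have "(L \<longlongrightarrow> ?G z) (at z within ball 0 1)"
    by (rule Lim_transform_eventually)
  moreover have "(L \<longlongrightarrow> L z) (at z within ball 0 1)"
  proof (rule tendsto_within_subset)
    show "(L \<longlongrightarrow> L z) (at z within cball 0 1 - {1})"
      using cont z by (auto simp: continuous_on_def)
  qed auto
  ultimately have "?G z = L z"
    using lim by (intro tendsto_unique) (auto simp: trivial_limit_within)
  then show ?thesis
    using hurwitz_lerch_branch[of z s v] cut z s by (simp add: lerch_convergent_def)
qed

lemma UN_half_planes: "(\<Union>N. {s. Re s > 1 - real N}) = UNIV"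
proof (intro equalityI subsetI)
  fix s :: complex
  obtain N :: nat where "1 - Re s < real N" using reals_Archimedean2 by blast
  then have "s \<in> {s. Re s > 1 - real N}" by simp
  then show "s \<in> (\<Union>N. {s. Re s > 1 - real N})" by blast
qed auto

lemma holomorphic_hurwitz_lerch_circle:
  assumes z: "norm z = 1" "z \<noteq> 1"
  shows "(\<lambda>s. hurwitz_lerch z s v) holomorphic_on UNIV"
  unfolding UN_half_planes[symmetric]
proof (rule holomorphic_on_UN_open)
  fix N :: nat
  obtain L where
    cont: "\<And>s. Re s > 1 - real N \<Longrightarrow> continuous_on (cball 0 1 - {1}) (\<lambda>z. L z s)"
    and hol: "\<And>z. z \<in> cball 0 1 - {1} \<Longrightarrow> L z holomorphic_on {s. Re s > 1 - real N}"
    and eq: "\<And>s z. Re s > 1 - real N \<Longrightarrow> z \<noteq> 1 \<Longrightarrow> lerch_convergent z s \<Longrightarrow> L z s = lerch_series z s v"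
    using lerch_circle_extension[of N v] by blast
  have "hurwitz_lerch z s v = L z s" if s: "s \<in> {s. Re s > 1 - real N}" for s
  proof (cases "Re s > 1")
    case True
    then have "lerch_convergent z s" using z by (simp add: lerch_convergent_def)
    then show ?thesis using eq[of s z] s z by (simp add: hurwitz_lerch_convergent)
  next
    case False
    have "L x s = lerch_series x s v" if "norm x < 1" for x
      using eq[of s x] s that by (cases "x = 1") (auto simp: lerch_convergent_def)
    then show ?thesis
      using hurwitz_lerch_eq_circle_extension[OF cont, of s s v z] s z False by auto
  qed
  moreover have "L z holomorphic_on {s. Re s > 1 - real N}"
    using z by (intro hol) auto
  ultimately show "(\<lambda>s. hurwitz_lerch z s v) holomorphic_on {s. Re s > 1 - real N}"
    by (metis (no_types, lifting) holomorphic_transform)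
qed (simp add: open_halfspace_Re_gt)

text \<open>
  The extensions to the half-planes \<open>Re s > 1 - N\<close> agree on overlaps by the identity theorem, since
  they all continue the same series.
\<close>
lemma hurwitz_zeta_extension_glue:
  assumes v: "Re v \<ge> 2"
  shows "\<exists>h. h holomorphic_on UNIV \<and> (\<forall>s. Re s > 1 \<longrightarrow> h s = (s - 1) * lerch_series 1 s v)"
proof -
  let ?H = "\<lambda>N. {s. Re s > 1 - real N}"
  from hurwitz_zeta_extension_large[OF v] obtain h where hol: "\<And>N. h N holomorphic_on ?H N"
    and eq: "\<And>N s. Re s > 1 \<Longrightarrow> h N s = (s - 1) * lerch_series 1 s v" by metis
  have agree: "h M s = h N s" if "s \<in> ?H M" "s \<in> ?H N" for M N s
  proof -
    have sub: "?H (min M N) \<subseteq> ?H M" "?H (min M N) \<subseteq> ?H N" by auto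
    have "h M s = h N s"
    proof (rule analytic_continuation_open[of "{s. Re s > 1}" "?H (min M N)" "h M" "h N" s])
      show "{s. Re s > 1} \<noteq> {}" by (auto intro: exI[of _ 2])
      show "connected (?H (min M N))" by (simp add: convex_connected convex_halfspace_Re_gt)
      show "s \<in> ?H (min M N)" using that by (auto simp: min_def)
      show "h M holomorphic_on ?H (min M N)" "h N holomorphic_on ?H (min M N)"
        using hol sub by (blast intro: holomorphic_on_subset)+
    qed (auto simp: open_halfspace_Re_gt eq)
    then show ?thesis .
  qed
  define f where "f s = h (SOME N. s \<in> ?H N) s" for s
  have f: "f s = h N s" if "s \<in> ?H N" for s N
    unfolding f_def using agree[OF someI[of "\<lambda>N. s \<in> ?H N", OF that] that] .
  have "f holomorphic_on UNIV"
    unfolding UN_half_planes[symmetric]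
  proof (rule holomorphic_on_UN_open)
    show "f holomorphic_on ?H N" for N
      by (rule holomorphic_transform[OF hol[of N]]) (rule f[symmetric])
  qed (simp add: open_halfspace_Re_gt)
  moreover have "f s = (s - 1) * lerch_series 1 s v" if "Re s > 1" for s
    using f[of s 0] eq[of s 0] that by simp
  ultimately show ?thesis by blast
qed

lemma hurwitz_zeta_extension:
  "\<exists>g. g holomorphic_on - {1} \<and> (\<forall>s. Re s > 1 \<longrightarrow> g s = lerch_series 1 s v)"
proof -
  obtain K :: nat where K: "2 - Re v < real K"
    using reals_Archimedean2 by blast
  then have "Re (v + of_nat K) \<ge> 2" by simp
  from hurwitz_zeta_extension_glue[OF this] obtain h where hol: "h holomorphic_on UNIV"
    and eq: "\<And>s. Re s > 1 \<Longrightarrow> h s = (s - 1) * lerch_series 1 s (v + of_nat K)" by blast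
  let ?g = "\<lambda>s. (\<Sum>j<K. 1 ^ j / (of_nat j + v) powr s) + h s / (s - 1)"
  have "?g s = lerch_series 1 s v" if "Re s > 1" for s
  proof -
    have "lerch_convergent 1 s" "s \<noteq> 1" using that by (auto simp: lerch_convergent_def)
    then show ?thesis using lerch_series_split[of 1 s v K] eq[OF that] by simp
  qed
  moreover have "?g holomorphic_on - {1}"
    by (intro holomorphic_intros holomorphic_lerch_term holomorphic_on_subset[OF hol]) auto
  ultimately show ?thesis by (intro exI[of _ ?g]) auto
qed

lemma hurwitz_zeta:
  shows hurwitz_zeta_holomorphic: "(\<lambda>s. hurwitz_zeta s v) holomorphic_on - {1}"
    and hurwitz_zeta_eq_series: "Re s > 1 \<Longrightarrow> hurwitz_zeta s v = lerch_series 1 s v"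
proof -
  have "\<exists>g. g holomorphic_on - {1} \<and> (\<forall>s\<in>{s. Re s > 1}. g s = lerch_series 1 s v)"
    using hurwitz_zeta_extension[of v] by auto
  from someI_ex[OF this]
  have "(\<lambda>s. hurwitz_zeta s v) holomorphic_on - {1} \<and>
      (\<forall>s\<in>{s. Re s > 1}. hurwitz_zeta s v = lerch_series 1 s v)"
    unfolding hurwitz_zeta_def analytic_continuation_def by (simp add: eta_contract_eq)
  then show "(\<lambda>s. hurwitz_zeta s v) holomorphic_on - {1}"
    "Re s > 1 \<Longrightarrow> hurwitz_zeta s v = lerch_series 1 s v" by auto
qed

text \<open>
  On the unit circle the values come from three sources: the series, the branch in \<open>z\<close>, and the Hurwitz
  zeta function. They nevertheless form one holomorphic function of \<open>s\<close>. The exception \<open>s = 1\<close> is caused by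
  \<open>z = 1\<close> alone.
\<close>
lemma holomorphic_hurwitz_lerch_s:
  assumes "norm z = 1"
  shows "(\<lambda>s. hurwitz_lerch z s v) holomorphic_on - {1}"
proof (cases "z = 1")
  case True
  have "hurwitz_lerch 1 s v = hurwitz_zeta s v" for s
    by (simp add: hurwitz_lerch_def hurwitz_zeta_eq_series)
  then show ?thesis
    using True hurwitz_zeta_holomorphic by simp
next
  case False
  then show ?thesis
    using holomorphic_hurwitz_lerch_circle[OF assms] by (blast intro: holomorphic_on_subset)
qed

section \<open>Extracting a residue class of terms from the series\<close>

definition rotation :: "nat \<Rightarrow> nat \<Rightarrow> complex" where
  "rotation n p = exp (\<i> * of_nat p * of_real pi / of_nat n)"

lemma rotation_power: "rotation n p = cis (pi / real n) ^ p"
  unfolding rotation_def cis_conv_exp exp_of_nat_mult[symmetric] by (simp add: field_simps)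

lemma rotation_period: "n > 0 \<Longrightarrow> rotation n p ^ (2 * n) = 1"
proof -
  assume "n > 0"
  have "rotation n p ^ (2 * n) = (cis (pi / real n) ^ (2 * n)) ^ p"
    unfolding rotation_power by (metis power_mult mult.commute)
  also have "cis (pi / real n) ^ (2 * n) = cis (2 * pi)"
    unfolding Complex.DeMoivre using \<open>n > 0\<close> by simp
  also have "\<dots> = 1" by simp
  finally show ?thesis by simp
qed

lemma norm_rotation [simp]: "norm (rotation n p) = 1"
  by (simp add: rotation_power norm_power)

lemma sum_powers_root_of_unity:
  fixes x :: complex
  assumes "x ^ N = 1"
  shows "(\<Sum>p=1..N. x ^ p) = (if x = 1 then of_nat N else 0)"
proof -
  have "(\<Sum>p=1..N. x ^ p) = x * (\<Sum>p<N. x ^ p)"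
    by (simp only: sum_distrib_left power_Suc[symmetric] sum_bounds_lt_plus1 One_nat_def)
  then show ?thesis
    using assms by (simp add: geometric_sum)
qed

text \<open>
  The sum is geometric with ratio \<open>exp (\<i> pi (j + 1 + n) / n)\<close>, the summand \<open>n\<close> coming from the sign
  \<open>(- 1)\<^sup>p\<close> in the weights and the \<open>1\<close> from their factor \<open>\<omega>\<^sup>p\<close>. So the surviving indices are those
  for which \<open>2n\<close> divides \<open>j + 1 + n\<close>.
\<close>
lemma sum_roots_filter:
  assumes n: "n > 0"
  shows "(\<Sum>p=1..2*n. (-1) ^ p * rotation n p * (- (w * rotation n p)) ^ j) =
    (if \<exists>l. j = 2 * n * l + (n - 1) then 2 * of_nat n * (-1) ^ (n + 1) * w ^ j else 0)"
proof -
  let ?\<rho> = "- (cis (pi / real n) ^ Suc j)"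
  have \<rho>: "?\<rho> = cis (pi * real (j + 1 + n) / real n)"
  proof -
    have "pi * real (j + 1 + n) / real n = real (Suc j) * (pi / real n) + pi"
      using n by (simp add: field_simps)
    then show ?thesis
      by (simp only: Complex.DeMoivre cis_mult[symmetric] cis_pi mult_minus1_right)
  qed
  have summand: "(-1) ^ p * rotation n p * (- (w * rotation n p)) ^ j = (- w) ^ j * ?\<rho> ^ p" for p
  proof -
    have "(- (w * rotation n p)) ^ j = (- w) ^ j * rotation n p ^ j"
      by (simp add: power_mult_distrib[symmetric])
    moreover have "rotation n p * rotation n p ^ j = (cis (pi / real n) ^ Suc j) ^ p"
      unfolding rotation_power by (metis power_Suc power_mult mult.commute)
    moreover have "?\<rho> ^ p = (-1) ^ p * (cis (pi / real n) ^ Suc j) ^ p"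
      by (rule power_minus)
    ultimately show ?thesis by (simp add: mult_ac)
  qed
  have \<rho>1: "?\<rho> = 1 \<longleftrightarrow> (\<exists>l. j = 2 * n * l + (n - 1))"
  proof
    assume "?\<rho> = 1"
    then have "cis (pi * real (j + 1 + n) / real n) = 1" unfolding \<rho> .
    then obtain r :: int where "pi * real (j + 1 + n) / real n = of_int (2 * r) * pi"
      unfolding cis_conv_exp exp_eq_1 by auto
    then have "pi * real (j + 1 + n) = pi * (of_int (2 * r) * real n)"
      using n by (simp add: field_simps)
    then have "real (j + 1 + n) = of_int (2 * r) * real n"
      by (simp only: mult_cancel_left pi_neq_zero simp_thms)
    then have *: "int (j + 1 + n) = 2 * r * int n"
      by (metis of_int_eq_iff of_int_mult of_int_of_nat_eq)
    have "r > 0"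
    proof (rule ccontr)
      assume "\<not> r > 0"
      then have "2 * r * int n \<le> 0" by (intro mult_nonpos_nonneg[of "2 * r"]) auto
      with * show False by simp
    qed
    define l where "l = nat (r - 1)"
    have "r = int l + 1" using \<open>r > 0\<close> by (simp add: l_def)
    with * have "int (j + 1 + n) = int (2 * (l + 1) * n)" by (simp add: algebra_simps)
    then have "j + 1 + n = 2 * (l + 1) * n" by (simp only: of_nat_eq_iff)
    then have "j = 2 * n * l + (n - 1)" using n by (simp add: algebra_simps)
    then show "\<exists>l. j = 2 * n * l + (n - 1)" ..
  next
    assume "\<exists>l. j = 2 * n * l + (n - 1)"
    then obtain l where j: "j = 2 * n * l + (n - 1)" ..
    have "j + 1 + n = n * (2 * (l + 1))" using n by (simp add: j algebra_simps)
    then have "pi * real (j + 1 + n) / real n = pi * (real n * (2 * real (l + 1))) / real n"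
      by (simp only: of_nat_mult of_nat_numeral)
    also have "\<dots> = 2 * pi * real (l + 1)"
      using n by simp
    finally have "pi * real (j + 1 + n) / real n = 2 * pi * real (l + 1)" .
    then show "?\<rho> = 1" unfolding \<rho> by (simp only: cis_multiple_2pi Ints_of_nat)
  qed
  have "(\<Sum>p=1..2*n. (-1) ^ p * rotation n p * (- (w * rotation n p)) ^ j) = (- w) ^ j * (\<Sum>p=1..2*n. ?\<rho> ^ p)"
    unfolding summand by (rule sum_distrib_left[symmetric])
  moreover have "(\<Sum>p=1..2*n. ?\<rho> ^ p) = (if ?\<rho> = 1 then 2 * of_nat n else 0)"
  proof -
    have "?\<rho> ^ (2 * n) = 1"
    proof -
      have "?\<rho> ^ (2 * n) = (cis (pi / real n) ^ Suc j) ^ (2 * n)"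
        by (rule power_minus_even) simp
      also have "\<dots> = rotation n (Suc j) ^ (2 * n)" by (simp only: rotation_power)
      finally show ?thesis using rotation_period[OF n] by simp
    qed
    from sum_powers_root_of_unity[OF this] show ?thesis by simp
  qed
  moreover have "(- w) ^ j = (-1) ^ (n + 1) * w ^ j" if "j = 2 * n * l + (n - 1)" for l
  proof -
    have "even j \<longleftrightarrow> even (n + 1)" using n by (auto simp: that)
    then have "(- 1 :: complex) ^ j = (- 1) ^ (n + 1)" by (simp add: uminus_power_if)
    then show ?thesis by (subst power_minus) simp
  qed
  ultimately show ?thesis
    unfolding \<rho>1 by (auto simp: mult_ac)
qed

text \<open>
  The weighted sum of the \<open>2n\<close> series is one series most of whose terms vanish. Stripping it of these
  terms leaves the same partial sums, so its value can be read off from the sparse series. Assuming mere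
  convergence lets the lemma serve inside the disc and on the unit circle alike.
\<close>
lemma lerch_multisection_sums:
  assumes n: "n > 0"
    and L: "\<And>p. p \<in> {1..2*n} \<Longrightarrow> (\<lambda>j. (- (w * rotation n p)) ^ j / (of_nat j + a) powr s) sums L p"
    and R: "(\<lambda>l. (w ^ (2 * n)) ^ l / (of_nat l + (- 1 + a + of_nat n) / (2 * of_nat n)) powr s) sums R"
  shows "(\<Sum>p=1..2*n. (-1) ^ p * rotation n p * L p) =
    (-1) ^ (n + 1) * w ^ (n - 1) * (2 * of_nat n) powr (1 - s) * R"
proof -
  let ?b = "(- 1 + a + of_nat n) / (2 * of_nat n)"
  let ?g = "\<lambda>l. 2 * n * l + (n - 1)"
  let ?F = "\<lambda>j. (if \<exists>l. j = ?g l then 2 * of_nat n * (-1) ^ (n + 1) * w ^ j else 0) / (of_nat j + a) powr s"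
  have "(\<lambda>j. \<Sum>p=1..2*n. (-1) ^ p * rotation n p * ((- (w * rotation n p)) ^ j / (of_nat j + a) powr s))
      sums (\<Sum>p=1..2*n. (-1) ^ p * rotation n p * L p)"
    by (intro sums_sum sums_mult L)
  then have "?F sums (\<Sum>p=1..2*n. (-1) ^ p * rotation n p * L p)"
    unfolding sum_roots_filter[OF n, symmetric] sum_divide_distrib by simp
  moreover have "strict_mono ?g"
    using n by (intro strict_monoI add_strict_right_mono) simp
  ultimately have "(\<lambda>l. ?F (?g l)) sums (\<Sum>p=1..2*n. (-1) ^ p * rotation n p * L p)"
    by (subst sums_mono_reindex) auto
  moreover have "?F (?g l) = (-1) ^ (n + 1) * w ^ (n - 1) * (2 * of_nat n) powr (1 - s) *
      ((w ^ (2 * n)) ^ l / (of_nat l + ?b) powr s)" for l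
  proof -
    have "of_nat (?g l) + a = (2 * of_nat n) * (of_nat l + ?b)"
      using n by (simp add: field_simps of_nat_diff)
    moreover have "((2 * of_nat n) * (of_nat l + ?b)) powr s = (2 * of_nat n) powr s * (of_nat l + ?b) powr s"
      by (rule powr_times_real_left) auto
    moreover have "(2 * of_nat n :: complex) powr (1 - s) = 2 * of_nat n / (2 * of_nat n) powr s"
      using n by (simp add: powr_diff)
    moreover have "w ^ ?g l = w ^ (n - 1) * (w ^ (2 * n)) ^ l"
      by (simp only: power_add power_mult[of w "2 * n" l]) (rule mult.commute)
    ultimately show ?thesis by (simp add: mult_ac)
  qed
  ultimately have "(\<lambda>l. (-1) ^ (n + 1) * w ^ (n - 1) * (2 * of_nat n) powr (1 - s) *
      ((w ^ (2 * n)) ^ l / (of_nat l + ?b) powr s)) sums (\<Sum>p=1..2*n. (-1) ^ p * rotation n p * L p)"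
    by (simp only:)
  moreover have "(\<lambda>l. (-1) ^ (n + 1) * w ^ (n - 1) * (2 * of_nat n) powr (1 - s) *
      ((w ^ (2 * n)) ^ l / (of_nat l + ?b) powr s)) sums
      ((-1) ^ (n + 1) * w ^ (n - 1) * (2 * of_nat n) powr (1 - s) * R)"
    by (rule sums_mult[OF R])
  ultimately show ?thesis by (rule sums_unique2)
qed

lemma lerch_multisection_series:
  assumes n: "n > 0" and conv: "lerch_convergent w s"
  shows "(\<Sum>p=1..2*n. (-1) ^ p * rotation n p * lerch_series (- (w * rotation n p)) s a) =
    (-1) ^ (n + 1) * w ^ (n - 1) * (2 * of_nat n) powr (1 - s) *
      lerch_series (w ^ (2 * n)) s ((- 1 + a + of_nat n) / (2 * of_nat n))"
proof -
  have "norm w ^ (2 * n) < 1" if "norm w < 1"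
    using n that by (intro power_less_one_iff[THEN iffD2]) auto
  then have "lerch_convergent (w ^ (2 * n)) s"
    using conv by (auto simp: lerch_convergent_def norm_power)
  moreover have "lerch_convergent (- (w * rotation n p)) s" for p
    using conv by (simp add: lerch_convergent_def norm_mult)
  ultimately show ?thesis
    by (intro lerch_multisection_sums[OF n lerch_series_sums lerch_series_sums])
qed

lemma power_in_lerch_cut: "z \<in> lerch_cut \<Longrightarrow> z ^ k \<in> lerch_cut"
  unfolding lerch_cut_def by (auto intro!: image_eqI[of _ _ "_ ^ k"] simp: one_le_power)

text \<open>
  Off the cut, both sides are holomorphic in \<open>w\<close> where \<open>w\<^sup>2\<^sup>n\<close> avoids the cut, a set that is star-shaped
  about \<open>0\<close> because the complement of the cut is, and they agree on the unit disc.
\<close>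
lemma lerch_multisection_branch:
  fixes s :: complex
  defines "G \<equiv> \<lambda>v. analytic_continuation (\<lambda>z. lerch_series z s v) (ball 0 1) (- lerch_cut)"
  assumes n: "n > 0" and w: "w ^ (2 * n) \<notin> lerch_cut"
  shows "(\<Sum>p=1..2*n. (-1) ^ p * rotation n p * G a (- (w * rotation n p))) =
    (-1) ^ (n + 1) * w ^ (n - 1) * (2 * of_nat n) powr (1 - s) *
      G ((- 1 + a + of_nat n) / (2 * of_nat n)) (w ^ (2 * n))"
proof -
  let ?S = "{w. w ^ (2 * n) \<notin> lerch_cut}"
  let ?b = "(- 1 + a + of_nat n) / (2 * of_nat n)"
  have hol: "G v holomorphic_on - lerch_cut" for v
    unfolding G_def by (rule lerch_branch_holomorphic)
  have rot: "(- (w * rotation n p)) ^ (2 * n) = w ^ (2 * n)" for w p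
    using rotation_period[OF n] by (simp add: power_mult_distrib)
  have ball: "w ^ (2 * n) \<in> ball 0 1" if "norm w < 1" for w :: complex
    using n that by (simp add: norm_power power_less_one_iff)
  have opn: "open ?S"
  proof -
    have "open ((\<lambda>w. w ^ (2 * n)) -` (- lerch_cut))"
      using closed_lerch_cut by (intro open_vimage continuous_intros) (auto simp: closed_def)
    then show ?thesis by (simp add: vimage_def)
  qed
  have sub: "ball 0 1 \<subseteq> ?S"
  proof
    fix w :: complex assume "w \<in> ball 0 1"
    then have "w ^ (2 * n) \<in> ball 0 1"
      by (intro ball) simp
    with ball_subset_Compl_lerch_cut have "w ^ (2 * n) \<in> - lerch_cut" by (rule subsetD)
    then show "w \<in> ?S" by simp
  qed
  have conn: "connected ?S"
  proof (rule starlike_imp_connected)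
    have "closed_segment 0 w \<subseteq> ?S" if w: "w \<in> ?S" for w
    proof
      fix x assume "x \<in> closed_segment 0 w"
      then obtain t where t: "0 \<le> t" "t \<le> 1" "x = of_real t * w"
        by (auto simp: in_segment scaleR_conv_of_real)
      then have "x ^ (2 * n) = of_real (t ^ (2 * n)) * w ^ (2 * n)"
        by (simp add: power_mult_distrib)
      moreover have "0 \<le> t ^ (2 * n)" "t ^ (2 * n) \<le> 1"
        using t by (auto intro: power_le_one)
      ultimately show "x \<in> ?S"
        using mult_of_real_in_lerch_cut_imp[of "t ^ (2 * n)" "w ^ (2 * n)"] w by auto
    qed
    moreover have "0 \<in> ?S" by (rule subsetD[OF sub]) simp
    ultimately show "starlike ?S" unfolding starlike_def by blast
  qed
  have holL: "(\<lambda>w. \<Sum>p=1..2*n. (-1) ^ p * rotation n p * G a (- (w * rotation n p))) holomorphic_on ?S"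
  proof -
    have "(\<lambda>w. G a (- (w * rotation n p))) holomorphic_on ?S" for p
    proof -
      have "(G a \<circ> (\<lambda>w. - (w * rotation n p))) holomorphic_on ?S"
        by (rule holomorphic_on_compose_gen[OF _ hol])
           (use power_in_lerch_cut[of "- (_ * rotation n p)" "2 * n"] rot in \<open>auto intro!: holomorphic_intros\<close>)
      then show ?thesis by (simp add: o_def)
    qed
    then show ?thesis by (intro holomorphic_intros)
  qed
  have holR: "(\<lambda>w. (-1) ^ (n + 1) * w ^ (n - 1) * (2 * of_nat n) powr (1 - s) * G ?b (w ^ (2 * n))) holomorphic_on ?S"
  proof -
    have "(G ?b \<circ> (\<lambda>w. w ^ (2 * n))) holomorphic_on ?S"
      by (rule holomorphic_on_compose_gen[OF _ hol]) (auto intro!: holomorphic_intros)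
    then show ?thesis by (intro holomorphic_intros) (simp add: o_def)
  qed
  have eq: "(\<Sum>p=1..2*n. (-1) ^ p * rotation n p * G a (- (w * rotation n p))) =
      (-1) ^ (n + 1) * w ^ (n - 1) * (2 * of_nat n) powr (1 - s) * G ?b (w ^ (2 * n))"
    if "w \<in> ball 0 1" for w
  proof -
    have "G v z = lerch_series z s v" if "norm z < 1" for v z
      unfolding G_def using that by (rule lerch_branch_eq_series)
    then show ?thesis
      using lerch_multisection_series[OF n, of w s a] that ball[of w]
      by (simp add: lerch_convergent_def norm_mult)
  qed
  have "ball 0 1 \<noteq> {}" "w \<in> ?S" using w by auto
  from analytic_continuation_open[OF open_ball opn this(1) conn sub holL holR eq this(2)]
  show ?thesis .
qed

text \<open>
  On the unit circle the identity is continued in \<open>s\<close> from the half-plane \<open>Re s > 1\<close>, where all the series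
  converge. The base points \<open>w\<close> with \<open>w\<^sup>2\<^sup>n = 1\<close>, where continuation in \<open>w\<close> is impossible, are covered.
\<close>
lemma lerch_multisection_circle:
  assumes n: "n > 0" and w: "norm w = 1" and s: "s \<noteq> 1"
  shows "(\<Sum>p=1..2*n. (-1) ^ p * rotation n p * hurwitz_lerch (- (w * rotation n p)) s a) =
    (-1) ^ (n + 1) * w ^ (n - 1) * (2 * of_nat n) powr (1 - s) *
      hurwitz_lerch (w ^ (2 * n)) s ((- 1 + a + of_nat n) / (2 * of_nat n))"
proof (rule analytic_continuation_open[of "{s. Re s > 1}" "- {1}"
      "\<lambda>s. \<Sum>p=1..2*n. (-1) ^ p * rotation n p * hurwitz_lerch (- (w * rotation n p)) s a"
      "\<lambda>s. (-1) ^ (n + 1) * w ^ (n - 1) * (2 * of_nat n) powr (1 - s) *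
        hurwitz_lerch (w ^ (2 * n)) s ((- 1 + a + of_nat n) / (2 * of_nat n))" s])
  show "{s. Re s > 1} \<noteq> {}" by (auto intro: exI[of _ 2])
  show "connected (- {1 :: complex})" by (rule connected_punctured_universe) simp
  show "(\<lambda>s. \<Sum>p=1..2*n. (-1) ^ p * rotation n p * hurwitz_lerch (- (w * rotation n p)) s a) holomorphic_on - {1}"
    by (intro holomorphic_intros holomorphic_hurwitz_lerch_s) (simp add: w norm_mult)
  show "(\<lambda>s. (-1) ^ (n + 1) * w ^ (n - 1) * (2 * of_nat n) powr (1 - s) *
      hurwitz_lerch (w ^ (2 * n)) s ((- 1 + a + of_nat n) / (2 * of_nat n))) holomorphic_on - {1}"
    by (intro holomorphic_intros holomorphic_hurwitz_lerch_s) (use n in \<open>auto simp: w norm_power\<close>)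
  fix s assume s: "s \<in> {s. Re s > 1}"
  then have "lerch_convergent z s" if "norm z = 1" for z
    using that by (simp add: lerch_convergent_def)
  then show "(\<Sum>p=1..2*n. (-1) ^ p * rotation n p * hurwitz_lerch (- (w * rotation n p)) s a) =
    (-1) ^ (n + 1) * w ^ (n - 1) * (2 * of_nat n) powr (1 - s) *
      hurwitz_lerch (w ^ (2 * n)) s ((- 1 + a + of_nat n) / (2 * of_nat n))"
    using lerch_multisection_series[OF n, of w s a] w
    by (simp add: hurwitz_lerch_convergent norm_mult norm_power)
qed (use s in \<open>auto simp: open_halfspace_Re_gt\<close>)

text \<open>
  All the roots of \<open>w\<^sup>2\<^sup>n\<close> have the same modulus, so the series converge at all of the points involved
  or at none, and the three cases in the definition of the function never mix except at the branch
  point.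
\<close>
lemma hurwitz_lerch_multisection:
  assumes n: "n > 0" and cut: "w ^ (2 * n) \<notin> lerch_cut \<or> w ^ (2 * n) = 1 \<and> s \<noteq> 1"
  shows "(\<Sum>p=1..2*n. (-1) ^ p * rotation n p * hurwitz_lerch (- (w * rotation n p)) s a) =
    (-1) ^ (n + 1) * w ^ (n - 1) * (2 * of_nat n) powr (1 - s) *
      hurwitz_lerch (w ^ (2 * n)) s ((- 1 + a + of_nat n) / (2 * of_nat n))"
proof -
  have conv1: "lerch_convergent (- (w * rotation n p)) s \<longleftrightarrow> lerch_convergent w s" for p
    by (simp add: lerch_convergent_def norm_mult)
  have norm1: "norm w ^ (2 * n) = 1 \<longleftrightarrow> norm w = 1"
    using n power_eq_1_iff[of "norm w" "2 * n"] by auto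
  have conv2: "lerch_convergent (w ^ (2 * n)) s \<longleftrightarrow> lerch_convergent w s"
    using n by (simp add: lerch_convergent_def norm_power norm1 power_less_one_iff)
  consider "lerch_convergent w s" | "\<not> lerch_convergent w s" "w ^ (2 * n) \<notin> lerch_cut"
    | "w ^ (2 * n) = 1" "s \<noteq> 1" using cut by blast
  then show ?thesis
  proof cases
    case 1
    then show ?thesis
      using lerch_multisection_series[OF n 1, of a] by (simp add: hurwitz_lerch_convergent conv1 conv2)
  next
    case 2
    have "- (w * rotation n p) \<notin> lerch_cut" for p
    proof
      assume "- (w * rotation n p) \<in> lerch_cut"
      from power_in_lerch_cut[OF this, of "2 * n"] have "w ^ (2 * n) \<in> lerch_cut"
        using rotation_period[OF n] by (simp add: power_mult_distrib)
      with 2 show False by blast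
    qed
    then show ?thesis
      using lerch_multisection_branch[OF n 2(2), of s a] 2
      by (simp add: hurwitz_lerch_branch conv1 conv2)
  next
    case 3
    have "norm w ^ (2 * n) = 1" using 3 by (metis norm_one norm_power)
    then have "norm w = 1" by (simp only: norm1)
    then show ?thesis using 3 by (intro lerch_multisection_circle n)
  qed
qed

theorem theorem4p155:
  fixes n :: nat and k m a :: complex
  assumes "n > 0"
    and "\<And>p. p \<in> {1..2 * n} \<Longrightarrow>
           hurwitz_lerch_defined (- exp (\<i> * (m + of_nat p * of_real pi / of_nat n))) (- k) a"
    and "hurwitz_lerch_defined (exp (2 * \<i> * m * of_nat n)) (- k)
           ((- 1 + a + of_nat n) / (2 * of_nat n))"
  shows "(\<Sum>p = 1..2 * n. (- 1) ^ p * exp (\<i> * of_nat p * of_real pi / of_nat n) *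
            hurwitz_lerch (- exp (\<i> * (m + of_nat p * of_real pi / of_nat n))) (- k) a) =
         (- 1) ^ (n + 1) * exp (\<i> * m * (- 1 + of_nat n)) * (2 * of_nat n) powr (1 + k) *
           hurwitz_lerch (exp (2 * \<i> * m * of_nat n)) (- k)
             ((- 1 + a + of_nat n) / (2 * of_nat n))"
proof -
  let ?w = "exp (\<i> * m)"
  have Z: "exp (2 * \<i> * m * of_nat n) = ?w ^ (2 * n)"
    by (simp add: exp_of_nat_mult[symmetric] mult_ac)
  have c: "exp (\<i> * m * (- 1 + of_nat n)) = ?w ^ (n - 1)"
    using \<open>n > 0\<close> by (simp add: exp_of_nat_mult[symmetric] of_nat_diff algebra_simps)
  have z: "exp (\<i> * (m + of_nat p * of_real pi / of_nat n)) = ?w * rotation n p" for p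
    by (simp add: rotation_def exp_add[symmetric] algebra_simps)
  have "?w ^ (2 * n) \<notin> lerch_cut \<or> ?w ^ (2 * n) = 1 \<and> - k \<noteq> 1"
    using assms(3) unfolding Z hurwitz_lerch_defined_def by blast
  from hurwitz_lerch_multisection[OF assms(1) this, of a] show ?thesis
    unfolding Z c z rotation_def[symmetric] by simp
qed

end
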